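(* Consider the switched dynamical system, its state space $E=M\times\mathcal E$, the distance $d$, the penalization $Z_t$ and the coupling measures $\mathbb{P}_{(x,i),(y,j)}$ described in the context. Then condition (A) holds true with these coupling measures: there exist $C_A,\gamma_A>0$ such that for all $u=(x,i)$, $v=(y,j)\in E$ and all $t\ge0$, $$\mathbb{E}_{u,v}\left[\frac{Z_t}{\mathbb{E}_uZ_t}\,d\big((X_t,I_t),(Y_t,J_t)\big)\right]\le C_Ae^{-\gamma_At}\,d(u,v),$$ where $Z_t=\exp\left(-\int_0^t\rho(X_s,I_s)ds\right)$ is computed along the first component $(X,I)$ of the coupling.
   Context: The environment $(I_t)_{t\ge0}$ is an irreducible continuous-time Markov chain on a finite state space $\mathcal E$, and $X_t\in\mathbb{R}^k$ solves $\dot X_t=F_{I_t}(X_t)$, where for each $i\in\mathcal E$, $F_i$ is a vector field on $\mathbb{R}^k$ (generating a flow) such that for all $x,y\in\mathbb{R}^k$ $$\langle F_i(x)-F_i(y),x-y\rangle\le-\gamma\|x-y\|^2$$ for some constant $\gamma>0$ not depending on $i\in\mathcal E$. For $R$ large enough the closed ball $M=\{\|x\|\le R\}$ is positively invariant for the flows of all the $F_i$; fix such an $R$ and restrict the process $(X_t,I_t)$ to $E=M\times\mathcal E$. The distance on $E$ is $$d((x,i),(y,j))=\mathbf 1_{i\ne j}+\mathbf 1_{i=j}\frac{\|x-y\|}{2R}.$$ The penalization is $Z_t=\exp\left(-\int_0^t\rho(X_s,I_s)ds\right)$ with $\rho:E\to\mathbb{R}_+$ Lipschitz for $d$. $\mathbb{P}_{(x,i)}$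 is the law of $(X_t,I_t)_{t\ge0}$ started from $(x,i)$, and $\mathbb{P}_j$ the law of the environment started from $j$. Coupling: for $x,y\in M$, $i,j\in\mathcal E$, $\mathbb{P}_{(x,i),(y,j)}$ is the joint law of $(X_t,I_t,Y_t,J_t)_{t\ge0}$, where $(X_t,I_t)_{t\ge0}$ has law $\mathbb{P}_{(x,i)}$, $(Y'_t,J'_t)_{t\ge0}$ has law $\mathbb{P}_{(y,j)}$ and is independent of $(X_t,I_t)_{t\ge0}$, $T_0=\inf\{t\ge0:I_t=J'_t\}$, and for all $t\ge0$ $$J_t=J'_t\mathbf 1_{T_0>t}+I_t\mathbf 1_{T_0\le t},\qquad Y_t=Y'_t\mathbf 1_{T_0>t}+\left(Y'_{T_0}+\int_{T_0}^tF_{I_s}(Y_s)ds\right)\mathbf 1_{T_0\le t}.$$ This is a Markovian coupling, i.e. $(X_t,I_t,Y_t,J_t)_{t\ge0}$ is Markov with respect to its natural filtration. *)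

theory Defs
  imports "HOL-Probability.Probability"
begin

text \<open>\<open>\<kappa> t i\<close> is the distribution at time \<open>t\<close> of the chain started from \<open>i\<close>; only its values at times \<open>t \<ge> 0\<close> are meaningful.\<close>

definition transition_semigroup :: "(real \<Rightarrow> 'e::finite \<Rightarrow> 'e pmf) \<Rightarrow> bool" where
  "transition_semigroup \<kappa> \<longleftrightarrow>
     (\<forall>i. \<kappa> 0 i = return_pmf i) \<and>
     (\<forall>s\<ge>0. \<forall>t\<ge>0. \<forall>i. \<kappa> (s + t) i = bind_pmf (\<kappa> s i) (\<kappa> t)) \<and>
     (\<forall>i j. ((\<lambda>t. pmf (\<kappa> t i) j) \<longlongrightarrow> of_bool (i = j)) (at_right 0))"

definition irreducible_semigroup :: "(real \<Rightarrow> 'e::finite \<Rightarrow> 'e pmf) \<Rightarrow> bool" where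
  "irreducible_semigroup \<kappa> \<longleftrightarrow> (\<forall>i j. \<exists>t\<ge>0. pmf (\<kappa> t i) j > 0)"

text \<open>Right-continuity with left limits, for the discrete topology on the state space.\<close>

definition cadlag_path :: "(real \<Rightarrow> 'e) \<Rightarrow> bool" where
  "cadlag_path f \<longleftrightarrow>
     (\<forall>t\<ge>0. \<forall>\<^sub>F s in at_right t. f s = f t) \<and>
     (\<forall>t>0. \<exists>e. \<forall>\<^sub>F s in at_left t. f s = e)"

text \<open>The last conjunct gives the finite-dimensional distributions along times
  \<open>0 = \<tau> 0 \<le> \<dots> \<le> \<tau> n\<close>; for \<open>n = 0\<close> it says that the chain starts from \<open>i\<close> almost surely.\<close>

definition markov_chain ::
  "'w measure \<Rightarrow> (real \<Rightarrow> 'e::finite \<Rightarrow> 'e pmf) \<Rightarrow> 'e \<Rightarrow> (real \<Rightarrow> 'w \<Rightarrow> 'e) \<Rightarrow> bool" where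
  "markov_chain P \<kappa> i I \<longleftrightarrow>
     prob_space P \<and>
     (\<forall>t\<ge>0. I t \<in> measurable P (count_space UNIV)) \<and>
     (\<forall>\<omega>\<in>space P. cadlag_path (\<lambda>t. I t \<omega>)) \<and>
     (\<forall>n (\<tau> :: nat \<Rightarrow> real) e. \<tau> 0 = 0 \<longrightarrow> mono_on {..n} \<tau> \<longrightarrow> e 0 = i \<longrightarrow>
        measure P {\<omega>\<in>space P. \<forall>k\<le>n. I (\<tau> k) \<omega> = e k} =
          (\<Prod>k<n. pmf (\<kappa> (\<tau> (Suc k) - \<tau> k) (e k)) (e (Suc k))))"

text \<open>Only nonnegative times are needed. Uniqueness of the trajectories and the semigroup property
  are not required here: they follow from the one-sided Lipschitz condition on the vector fields.\<close>

definition forward_flow :: "('a::real_normed_vector \<Rightarrow> 'a) \<Rightarrow> (real \<Rightarrow> 'a \<Rightarrow> 'a) \<Rightarrow> bool" where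
  "forward_flow G \<phi> \<longleftrightarrow>
     (\<forall>x. \<phi> 0 x = x \<and>
        (\<forall>t\<ge>0. ((\<lambda>s. \<phi> s x) has_vector_derivative G (\<phi> t x)) (at t within {0..})))"

definition positively_invariant :: "(real \<Rightarrow> 'a \<Rightarrow> 'a) \<Rightarrow> 'a set \<Rightarrow> bool" where
  "positively_invariant \<phi> M \<longleftrightarrow> (\<forall>t\<ge>0. \<phi> t ` M \<subseteq> M)"

text \<open>\<open>(X, I)\<close> is a realization on \<open>P\<close> of the law started from \<open>(x, i)\<close>. Since \<open>I\<close> jumps,
  the equation \<open>X' = F\<^sub>I(X)\<close> is read in integral form; at \<open>t = 0\<close> it gives \<open>X 0 = x\<close>.\<close>

definition switched_process ::
  "'w measure \<Rightarrow> (real \<Rightarrow> 'e::finite \<Rightarrow> 'e pmf) \<Rightarrow> ('e \<Rightarrow> real^'k \<Rightarrow> real^'k) \<Rightarrow>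
    (real^'k) \<times> 'e \<Rightarrow> (real \<Rightarrow> 'w \<Rightarrow> real^'k) \<Rightarrow> (real \<Rightarrow> 'w \<Rightarrow> 'e) \<Rightarrow> bool" where
  "switched_process P \<kappa> F u X I \<longleftrightarrow>
     markov_chain P \<kappa> (snd u) I \<and>
     (\<forall>t\<ge>0. X t \<in> borel_measurable P) \<and>
     (\<forall>\<omega>\<in>space P. \<forall>t\<ge>0.
        ((\<lambda>s. F (I s \<omega>) (X s \<omega>)) has_integral (X t \<omega> - fst u)) {0..t})"

text \<open>Independence of two processes on the time set \<open>[0, \<infinity>)\<close>, as random elements of the
  product measurable space.\<close>

definition indep_processes ::
  "'w measure \<Rightarrow> (real \<Rightarrow> 'w \<Rightarrow> 'a::topological_space \<times> 'e) \<Rightarrow> (real \<Rightarrow> 'w \<Rightarrow> 'a \<times> 'e) \<Rightarrow> bool" where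
  "indep_processes P U V \<longleftrightarrow>
     prob_space.indep_var P
       (PiM {0..} (\<lambda>_. borel \<Otimes>\<^sub>M count_space UNIV)) (\<lambda>\<omega>. \<lambda>t\<in>{0..}. U t \<omega>)
       (PiM {0..} (\<lambda>_. borel \<Otimes>\<^sub>M count_space UNIV)) (\<lambda>\<omega>. \<lambda>t\<in>{0..}. V t \<omega>)"

text \<open>Extended-real valued, so that the value is \<open>\<infinity>\<close> if the two chains never meet.\<close>

definition meeting_time :: "(real \<Rightarrow> 'w \<Rightarrow> 'e) \<Rightarrow> (real \<Rightarrow> 'w \<Rightarrow> 'e) \<Rightarrow> 'w \<Rightarrow> ereal" where
  "meeting_time I J' \<omega> = (INF t\<in>{t. t \<ge> 0 \<and> I t \<omega> = J' t \<omega>}. ereal t)"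

text \<open>\<open>(X, I, Y, J)\<close> is a realization on \<open>P\<close> of the coupling started from \<open>(u, v)\<close>. After the meeting
  time, \<open>Y\<close> is specified implicitly, as the solution of an integral equation.\<close>

definition coupled_process ::
  "'w measure \<Rightarrow> (real \<Rightarrow> 'e::finite \<Rightarrow> 'e pmf) \<Rightarrow> ('e \<Rightarrow> real^'k \<Rightarrow> real^'k) \<Rightarrow>
    (real^'k) \<times> 'e \<Rightarrow> (real^'k) \<times> 'e \<Rightarrow>
    (real \<Rightarrow> 'w \<Rightarrow> real^'k) \<Rightarrow> (real \<Rightarrow> 'w \<Rightarrow> 'e) \<Rightarrow>
    (real \<Rightarrow> 'w \<Rightarrow> real^'k) \<Rightarrow> (real \<Rightarrow> 'w \<Rightarrow> 'e) \<Rightarrow> bool" where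
  "coupled_process P \<kappa> F u v X I Y J \<longleftrightarrow>
     (\<exists>Y' J'.
        switched_process P \<kappa> F u X I \<and>
        switched_process P \<kappa> F v Y' J' \<and>
        indep_processes P (\<lambda>t \<omega>. (X t \<omega>, I t \<omega>)) (\<lambda>t \<omega>. (Y' t \<omega>, J' t \<omega>)) \<and>
        (\<forall>t\<ge>0. Y t \<in> borel_measurable P) \<and>
        (\<forall>\<omega>\<in>space P. \<forall>t\<ge>0.
           let T0 = meeting_time I J' \<omega>; T = real_of_ereal T0 in
             J t \<omega> = (if T0 > ereal t then J' t \<omega> else I t \<omega>) \<and>
             (if T0 > ereal t then Y t \<omega> = Y' t \<omega>
              else ((\<lambda>s. F (I s \<omega>) (Y s \<omega>)) has_integral (Y t \<omega> - Y' T \<omega>)) {T..t})))"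

definition switched_dist ::
  "real \<Rightarrow> 'a::real_normed_vector \<times> 'e \<Rightarrow> 'a \<times> 'e \<Rightarrow> real" where
  "switched_dist R u v =
     of_bool (snd u \<noteq> snd v) + of_bool (snd u = snd v) * (norm (fst u - fst v) / (2 * R))"

definition penalization ::
  "('a \<times> 'e \<Rightarrow> real) \<Rightarrow> (real \<Rightarrow> 'w \<Rightarrow> 'a) \<Rightarrow> (real \<Rightarrow> 'w \<Rightarrow> 'e) \<Rightarrow> real \<Rightarrow> 'w \<Rightarrow> real" where
  "penalization \<rho> X I t \<omega> = exp (- integral {0..t} (\<lambda>s. \<rho> (X s \<omega>, I s \<omega>)))"

end

theory Submission
  imports Defs
begin

text \<open>If the environments start in the same state they coincide, and the two positions solve the
  same equation, so that dissipativity contracts their distance while \<open>Z\<^sub>t / E Z\<^sub>t\<close> has mean one.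
  Otherwise fix \<open>h\<close> and \<open>p > 0\<close> such that all transition probabilities over a time \<open>h\<close> are at
  least \<open>p\<close>. Whatever the path of \<open>(X, I)\<close>, the independent chain \<open>J'\<close> misses it at the times
  \<open>0, h, \<dots>, n h\<close> with probability at most \<open>(1 - p)\<^sup>n\<close>. This bound is uniform in the path, so it
  survives weighting by \<open>Z\<^sub>t\<close>, which depends on \<open>(X, I)\<close> only. Outside this event with
  \<open>n h \<approx> t / 2\<close> the positions have contracted for a time at least \<open>t / 2\<close>.\<close>

text \<open>Three obstacles shape the argument. A path solves its equation only in integrated form,
  so no differential inequality for a norm is at hand; contraction is read off from increments, with
  quadratic errors, and this requires fields bounded on bounded sets, which monotonicity provides.
  Positive invariance of \<open>M\<close> concerns each flow separately, whereas the environment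
  switches; it is turned into the sign condition \<open>F i x \<bullet> x \<le> 0\<close> for
  \<open>norm x \<ge> R\<close>, which can be used along any switching path. Finally, conditioning
  on the path of \<open>(X, I)\<close> becomes a finite sum over the values of \<open>I\<close> at
  the grid times, once the weight is known to be measurable for the sigma-algebra of
  \<open>(X, I)\<close>. The case distinction on the initial states comes from the factor
  \<open>switched_dist R u v\<close>: it is 1 if the states differ, so any decaying bound will do,
  but it can be arbitrarily small if they agree, and then it has to come out of the contraction
  itself.\<close>

section \<open>Contraction and boundedness without differentiability\<close>

text \<open>Over N equal pieces the increments add up to at most C (b - a)^2 / N, which vanishes as
  N grows. This stands in for a nonpositive derivative.\<close>

lemma quadratic_increments_imp_le:
  fixes f :: "real \<Rightarrow> real"
  assumes "a \<le> b"
    and incr: "\<And>s t. a \<le> s \<Longrightarrow> s \<le> t \<Longrightarrow> t \<le> b \<Longrightarrow> f t - f s \<le> C * (t - s)\<^sup>2"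
  shows "f b \<le> f a"
proof -
  have bound: "f b - f a \<le> C * (b - a)\<^sup>2 * inverse (real (Suc n))" for n
  proof -
    define N where "N = real (Suc n)"
    define \<tau> where "\<tau> k = a + real k * ((b - a) / N)" for k
    have N: "N > 0" by (simp add: N_def)
    have \<tau>: "a \<le> \<tau> k \<and> \<tau> k \<le> \<tau> (Suc k) \<and> \<tau> (Suc k) \<le> b" if "k < Suc n" for k
    proof -
      have "real (Suc k) * ((b - a) / N) \<le> N * ((b - a) / N)"
        using that assms(1) N by (intro mult_right_mono) (auto simp: N_def)
      moreover have "N * ((b - a) / N) = b - a" using N by simp
      moreover have d: "0 \<le> (b - a) / N" using assms(1) N by simp
      have "0 \<le> real k * ((b - a) / N)" using d by (intro mult_nonneg_nonneg) auto
      moreover have "real (Suc k) * ((b - a) / N) = real k * ((b - a) / N) + (b - a) / N"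
        by (simp only: of_nat_Suc distrib_right mult_1_left)
      ultimately show ?thesis
        unfolding \<tau>_def using d by linarith
    qed
    have "\<tau> 0 = a" "\<tau> (Suc n) = b" using N by (auto simp: \<tau>_def N_def)
    then have "f b - f a = (\<Sum>k<Suc n. f (\<tau> (Suc k)) - f (\<tau> k))"
      using sum_lessThan_telescope[of "\<lambda>k. f (\<tau> k)" "Suc n"] by simp
    also have "\<dots> \<le> (\<Sum>k<Suc n. C * ((b - a) / N)\<^sup>2)"
    proof (rule sum_mono)
      fix k assume "k \<in> {..<Suc n}"
      then have "f (\<tau> (Suc k)) - f (\<tau> k) \<le> C * (\<tau> (Suc k) - \<tau> k)\<^sup>2"
        using \<tau>[of k] by (intro incr) auto
      moreover have "\<tau> (Suc k) - \<tau> k = (b - a) / N"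
        by (simp add: \<tau>_def algebra_simps add_divide_distrib diff_divide_distrib)
      ultimately show "f (\<tau> (Suc k)) - f (\<tau> k) \<le> C * ((b - a) / N)\<^sup>2" by simp
    qed
    also have "\<dots> = N * (C * ((b - a) / N)\<^sup>2)" by (simp only: sum_constant card_lessThan N_def)
    also have "\<dots> = C * (b - a)\<^sup>2 * inverse N"
      using N by (simp add: power_divide power2_eq_square divide_inverse)
    finally show ?thesis by (simp add: N_def)
  qed
  have "(\<lambda>n. C * (b - a)\<^sup>2 * inverse (real (Suc n))) \<longlonglongrightarrow> C * (b - a)\<^sup>2 * 0"
    by (intro tendsto_intros LIMSEQ_inverse_real_of_nat)
  then have "f b - f a \<le> C * (b - a)\<^sup>2 * 0"
    by (rule LIMSEQ_le_const) (use bound in blast)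
  then show ?thesis by simp
qed

text \<open>Neither \<open>D\<close> nor \<open>norm D\<close> is known to be differentiable here, since \<open>g\<close> is only integrable;
  the squared norm is controlled up to errors that are quadratic in the increment of time.\<close>

lemma norm_le_exp_if_dissipative:
  fixes D g :: "real \<Rightarrow> 'a::euclidean_space"
  assumes "a \<le> b" "c \<ge> 0"
    and D: "\<And>s t. a \<le> s \<Longrightarrow> s \<le> t \<Longrightarrow> t \<le> b \<Longrightarrow> (g has_integral (D t - D s)) {s..t}"
    and K: "\<And>r. a \<le> r \<Longrightarrow> r \<le> b \<Longrightarrow> norm (g r) \<le> K"
    and diss: "\<And>r. a \<le> r \<Longrightarrow> r \<le> b \<Longrightarrow> g r \<bullet> D r \<le> - c * (norm (D r))\<^sup>2"
  shows "norm (D b) \<le> exp (- c * (b - a)) * norm (D a)"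
proof -
  have K0: "K \<ge> 0" using K[of a] assms(1) norm_ge_zero order_trans by blast
  \<comment> \<open>\<open>B\<close> bounds \<open>norm (D t)\<close> because \<open>D\<close> is
    Lipschitz with constant \<open>K\<close>. In \<open>L\<close>, the term
    \<open>4 * c * K * B\<close> pays for replacing \<open>norm (D r)\<close> by
    \<open>norm (D s)\<close> in the dissipation, and \<open>2 * K\<^sup>2\<close> for the
    remainders \<open>g r \<bullet> (D t - D r)\<close> and
    \<open>g r \<bullet> (D s - D r)\<close>.\<close>
  define B where "B = norm (D a) + K * (b - a)"
  define L where "L = 4 * c * K * B + 2 * K\<^sup>2"
  define f where "f t = exp (2 * c * (t - a)) * (norm (D t))\<^sup>2" for t
  have lip: "norm (D t - D s) \<le> K * (t - s)" if "a \<le> s" "s \<le> t" "t \<le> b" for s t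
    using has_integral_bound_real[OF K0 finite.emptyI D[OF that]] K that by auto
  have B: "norm (D t) \<le> B" if "a \<le> t" "t \<le> b" for t
  proof -
    have "norm (D t) \<le> norm (D a) + norm (D t - D a)"
      by (metis add.commute diff_add_cancel norm_triangle_ineq)
    also have "\<dots> \<le> norm (D a) + K * (t - a)" using lip[of a t] that by simp
    also have "\<dots> \<le> B" using that K0 by (simp add: B_def mult_left_mono)
    finally show ?thesis .
  qed
  have B0: "B \<ge> 0" using B[of a] assms(1) norm_ge_zero order_trans by blast
  have L0: "L \<ge> 0" using assms(2) K0 B0 by (simp add: L_def)
  \<comment> \<open>The difference of squares is \<open>(D t - D s) \<bullet> (D t + D s)\<close>,
    the integral of \<open>g r\<close> against a constant vector; this replaces a product rule. The
    integrand is bounded by comparing \<open>D t + D s\<close> with twice \<open>D r\<close>, where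
    dissipativity applies.\<close>
  have step: "(norm (D t))\<^sup>2 - (norm (D s))\<^sup>2 \<le> (t - s) * (- 2 * c * (norm (D s))\<^sup>2 + L * (t - s))"
    if st: "a \<le> s" "s \<le> t" "t \<le> b" for s t
  proof -
    have pw: "g r \<bullet> (D t + D s) \<le> - 2 * c * (norm (D s))\<^sup>2 + L * (t - s)"
      if r: "r \<in> {s..t}" for r
    proof -
      have ab: "a \<le> r" "r \<le> b" using r st by auto
      have "g r \<bullet> (D t + D s) = 2 * (g r \<bullet> D r) + g r \<bullet> (D t - D r) + g r \<bullet> (D s - D r)"
        by (simp add: algebra_simps)
      moreover have "g r \<bullet> (D t - D r) \<le> K * (K * (t - s))"
      proof -
        have "g r \<bullet> (D t - D r) \<le> norm (g r) * norm (D t - D r)" by (rule norm_cauchy_schwarz)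
        also have "\<dots> \<le> K * (K * (t - r))"
          using K[OF ab] lip[of r t] r st K0 by (intro mult_mono) auto
        also have "\<dots> \<le> K * (K * (t - s))" using r K0 by (intro mult_left_mono) auto
        finally show ?thesis .
      qed
      moreover have "g r \<bullet> (D s - D r) \<le> K * (K * (t - s))"
      proof -
        have "g r \<bullet> (D s - D r) \<le> norm (g r) * norm (D s - D r)" by (rule norm_cauchy_schwarz)
        also have "\<dots> \<le> K * (K * (r - s))"
          using K[OF ab] lip[of s r] r st K0 by (intro mult_mono) (auto simp: norm_minus_commute)
        also have "\<dots> \<le> K * (K * (t - s))" using r K0 by (intro mult_left_mono) auto
        finally show ?thesis .
      qed
      moreover have "(norm (D s))\<^sup>2 - 2 * K * B * (t - s) \<le> (norm (D r))\<^sup>2"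
      proof -
        have "(norm (D s))\<^sup>2 - (norm (D r))\<^sup>2 = (D s - D r) \<bullet> (D s + D r)"
          by (simp add: power2_norm_eq_inner algebra_simps inner_commute)
        also have "\<dots> \<le> norm (D s - D r) * norm (D s + D r)" by (rule norm_cauchy_schwarz)
        also have "\<dots> \<le> (K * (r - s)) * (B + B)"
          using lip[of s r] r st K0 B[OF ab] B[of s] norm_triangle_ineq[of "D s" "D r"]
          by (intro mult_mono) (auto simp: norm_minus_commute)
        also have "\<dots> \<le> (K * (t - s)) * (B + B)"
          using r K0 B0 by (intro mult_right_mono mult_left_mono) auto
        finally show ?thesis by (simp add: algebra_simps)
      qed
      then have "c * ((norm (D s))\<^sup>2 - 2 * K * B * (t - s)) \<le> c * (norm (D r))\<^sup>2"
        using assms(2) by (rule mult_left_mono)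
      moreover note diss[OF ab]
      ultimately show ?thesis by (simp add: L_def power2_eq_square algebra_simps)
    qed
    have "(norm (D t))\<^sup>2 - (norm (D s))\<^sup>2 = (D t - D s) \<bullet> (D t + D s)"
      by (simp add: power2_norm_eq_inner algebra_simps inner_commute)
    moreover have i1: "((\<lambda>r. g r \<bullet> (D t + D s)) has_integral (D t - D s) \<bullet> (D t + D s)) {s..t}"
      using has_integral_linear[OF D[OF st] bounded_linear_inner_left] by (simp add: o_def)
    moreover have i2: "((\<lambda>r. - 2 * c * (norm (D s))\<^sup>2 + L * (t - s)) has_integral
        (t - s) *\<^sub>R (- 2 * c * (norm (D s))\<^sup>2 + L * (t - s))) {s..t}"
      using has_integral_const_real[of "- 2 * c * (norm (D s))\<^sup>2 + L * (t - s)" s t] st by simp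
    ultimately show ?thesis using has_integral_le[OF i1 i2 pw] by simp
  qed
  have "f b \<le> f a"
  proof (rule quadratic_increments_imp_le[OF assms(1)])
    fix s t assume st: "a \<le> s" "s \<le> t" "t \<le> b"
    define e where "e = exp (2 * c * (t - a))"
    \<comment> \<open>Relative to its value at \<open>t\<close>, the weight grows by
      \<open>1 - exp (- x) \<le> x\<close> with \<open>x = 2 * c * (t - s)\<close>. This is offset
      by the first-order decay in \<open>step\<close>, and only the quadratic error is left.\<close>
    have "1 + (- (2 * c * (t - s))) \<le> exp (- (2 * c * (t - s)))" by (rule exp_ge_add_one_self)
    then have "(1 - exp (- (2 * c * (t - s)))) * (norm (D s))\<^sup>2 \<le> (2 * c * (t - s)) * (norm (D s))\<^sup>2"
      by (intro mult_right_mono) auto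
    moreover have "exp (2 * c * (s - a)) = e * exp (- (2 * c * (t - s)))"
      by (simp add: e_def algebra_simps flip: exp_add)
    then have "f t - f s = e * (((norm (D t))\<^sup>2 - (norm (D s))\<^sup>2)
        + (1 - exp (- (2 * c * (t - s)))) * (norm (D s))\<^sup>2)"
      by (simp add: f_def flip: e_def) (simp add: algebra_simps)
    moreover have "(norm (D t))\<^sup>2 - (norm (D s))\<^sup>2 + 2 * c * (t - s) * (norm (D s))\<^sup>2 \<le> L * (t - s)\<^sup>2"
      using step[OF st] by (simp add: power2_eq_square algebra_simps)
    moreover have "e > 0" by (simp add: e_def)
    ultimately have "f t - f s \<le> e * (L * (t - s)\<^sup>2)"
      by (simp only: mult_le_cancel_left_pos)
    also have "\<dots> \<le> exp (2 * c * (b - a)) * (L * (t - s)\<^sup>2)"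
      using st assms(2) L0 by (intro mult_right_mono) (auto simp: e_def mult_left_mono)
    finally show "f t - f s \<le> exp (2 * c * (b - a)) * L * (t - s)\<^sup>2" by (simp add: mult.assoc)
  qed
  then have "exp (- (2 * c * (b - a))) * (exp (2 * c * (b - a)) * (norm (D b))\<^sup>2)
      \<le> exp (- (2 * c * (b - a))) * (norm (D a))\<^sup>2"
    by (intro mult_left_mono) (auto simp: f_def)
  then have "(norm (D b))\<^sup>2 \<le> exp (- (2 * c * (b - a))) * (norm (D a))\<^sup>2"
    by (simp flip: exp_add mult.assoc)
  also have "\<dots> = (exp (- c * (b - a)) * norm (D a))\<^sup>2"
    by (simp add: power_mult_distrib exp_double[symmetric] algebra_simps)
  finally show ?thesis by (rule power2_le_imp_le) simp
qed

text \<open>Monotonicity tested against each \<open>z\<close> in a finite set \<open>S\<close>,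
  whose hull is a cube containing the ball of radius \<open>r + 1\<close>, bounds
  \<open>F x \<bullet> (x - z)\<close> by \<open>K\<close>. The bound is affine in \<open>z\<close>,
  so it extends to the hull, and \<open>z = x - sgn (F x)\<close> turns the left side into
  \<open>norm (F x)\<close>. The margin 1 in the radius leaves room for this unit step.\<close>

lemma monotone_bounded_on_cball:
  fixes F :: "'a::euclidean_space \<Rightarrow> 'a"
  assumes mono: "\<And>x y. (F x - F y) \<bullet> (x - y) \<le> 0"
  obtains K where "\<And>x. norm x \<le> r \<Longrightarrow> norm (F x) \<le> K"
proof (cases "r \<ge> 0")
  case False
  then have "norm x \<le> r \<Longrightarrow> norm (F x) \<le> 0" for x
    using norm_ge_zero[of x] by linarith
  then show ?thesis using that by blast
next
  case True
  then have "0 < r + 1" by simp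
  then obtain S :: "'a set" where S: "finite S"
      "cbox (0 - sum ((*\<^sub>R) (r + 1)) Basis) (0 + sum ((*\<^sub>R) (r + 1)) Basis) = convex hull S"
    by (rule cube_convex_hull)
  have sub: "z \<in> convex hull S" if "norm z \<le> r + 1" for z
    unfolding S(2)[symmetric] mem_box
    using that Basis_le_norm[of _ z]
    by (fastforce simp: inner_sum_left inner_Basis if_distrib[of "\<lambda>x. _ * x"] cong: if_cong)
  define K where "K = (\<Sum>z\<in>S. norm (F z) * (r + norm z))"
  have "norm (F x) \<le> K" if x: "norm x \<le> r" for x
  proof -
    have "S \<subseteq> {z. (- F x) \<bullet> z \<le> K - F x \<bullet> x}"
    proof
      fix z assume z: "z \<in> S"
      have "F x \<bullet> (x - z) \<le> F z \<bullet> (x - z)" using mono[of x z] by (simp add: inner_diff_left)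
      also have "\<dots> \<le> norm (F z) * norm (x - z)" by (rule norm_cauchy_schwarz)
      also have "\<dots> \<le> norm (F z) * (r + norm z)"
        using norm_triangle_ineq4[of x z] x by (intro mult_left_mono) auto
      also have "\<dots> \<le> K" unfolding K_def
        using S(1) z True by (intro member_le_sum) auto
      finally show "z \<in> {z. (- F x) \<bullet> z \<le> K - F x \<bullet> x}" by (simp add: inner_diff_right)
    qed
    then have "convex hull S \<subseteq> {z. (- F x) \<bullet> z \<le> K - F x \<bullet> x}"
      by (rule hull_minimal) (rule convex_halfspace_le)
    moreover have "x - sgn (F x) \<in> convex hull S"
      using norm_triangle_ineq4[of x "sgn (F x)"] x by (intro sub) (auto simp: norm_sgn split: if_splits)
    ultimately have "F x \<bullet> sgn (F x) \<le> K" by (auto simp: inner_diff_right)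
    moreover have "F x \<bullet> sgn (F x) = norm (F x)"
      by (cases "F x = 0") (simp_all add: sgn_div_norm power2_norm_eq_inner[symmetric] power2_eq_square flip: mult.assoc)
    ultimately show ?thesis by simp
  qed
  then show ?thesis using that by blast
qed

lemma has_integral_increments:
  fixes X :: "real \<Rightarrow> 'a::euclidean_space"
  assumes X: "\<And>t. a \<le> t \<Longrightarrow> (g has_integral (X t - x)) {a..t}" and st: "a \<le> s" "s \<le> t"
  shows "(g has_integral (X t - X s)) {s..t}"
proof -
  have "g integrable_on {a..t}" using X[of t] st by auto
  then have "g integrable_on {s..t}" by (rule integrable_on_subinterval) (use st in auto)
  then obtain J where J: "(g has_integral J) {s..t}" by blast
  have "(g has_integral (X s - x + J)) {a..t}"
    by (rule has_integral_combine[OF st X[OF st(1)] J])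
  then have "X s - x + J = X t - x" using X[of t] st by (meson has_integral_unique order_trans)
  then have "J = X t - X s" by (simp add: algebra_simps)
  then show ?thesis using J by simp
qed

lemma continuous_on_if_has_integral:
  fixes X :: "real \<Rightarrow> 'a::euclidean_space"
  assumes X: "\<And>t. a \<le> t \<Longrightarrow> (g has_integral (X t - x)) {a..t}"
  shows "continuous_on {a..b} X"
proof (cases "a \<le> b")
  case True
  have "continuous_on {a..b} (\<lambda>t. x + integral {a..t} g)"
    using X[OF True] by (intro continuous_intros indefinite_integral_continuous_1) auto
  then show ?thesis
    by (rule continuous_on_cong[THEN iffD1, rotated -1]) (use integral_unique[OF X] in auto)
qed auto

section \<open>Invariance of the ball under switching\<close>

text \<open>At \<open>p\<close> on the sphere, \<open>G p \<bullet> p > 0\<close> would push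
  \<open>\<phi> s p \<bullet> p\<close> above \<open>R * R\<close> for small \<open>s > 0\<close>,
  which by Cauchy-Schwarz means leaving the ball. Monotonicity along the ray through
  \<open>p\<close> then carries the sign outwards.\<close>

lemma inner_le_0_outside_invariant_cball:
  fixes G :: "'a::euclidean_space \<Rightarrow> 'a"
  assumes flow: "forward_flow G \<phi>" and inv: "positively_invariant \<phi> (cball 0 R)"
    and mono: "\<And>x y. (G x - G y) \<bullet> (x - y) \<le> 0"
    and "R > 0" "norm x \<ge> R"
  shows "G x \<bullet> x \<le> 0"
proof -
  have boundary: "G p \<bullet> p \<le> 0" if p: "norm p = R" for p
  proof (rule ccontr)
    assume pos: "\<not> G p \<bullet> p \<le> 0"
    have 0: "\<phi> 0 p = p" using flow by (simp add: forward_flow_def)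
    have "((\<lambda>s. \<phi> s p) has_vector_derivative G p) (at 0 within {0..})"
      using flow 0 unfolding forward_flow_def by (metis order_refl)
    then have "((\<lambda>s. \<phi> s p \<bullet> p) has_real_derivative G p \<bullet> p) (at 0 within {0..})"
      unfolding has_real_derivative_iff_has_vector_derivative
      by (rule bounded_linear.has_vector_derivative[OF bounded_linear_inner_left])
    then obtain d where d: "d > 0" "\<And>h. 0 < h \<Longrightarrow> 0 + h \<in> {0..} \<Longrightarrow> h < d \<Longrightarrow> \<phi> 0 p \<bullet> p < \<phi> (0 + h) p \<bullet> p"
      using has_real_derivative_pos_inc_right pos by (metis not_le)
    have "R * R < \<phi> (d/2) p \<bullet> p"
      using d(2)[of "d/2"] d(1) 0 p by (simp add: power2_norm_eq_inner[symmetric] power2_eq_square)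
    also have "\<dots> \<le> norm (\<phi> (d/2) p) * norm p" by (rule norm_cauchy_schwarz)
    also have "\<dots> \<le> R * R"
    proof -
      have "\<phi> (d/2) p \<in> cball 0 R"
        using inv d(1) p unfolding positively_invariant_def by (force simp: image_subset_iff)
      then show ?thesis using p \<open>R > 0\<close> by simp
    qed
    finally show False by simp
  qed
  show ?thesis
  proof (cases "norm x = R")
    case False
    define l where "l = R / norm x"
    have "norm x > R" "norm x > 0" using assms(4,5) False by linarith+
    then have l: "0 < l" "l < 1" using assms(4) by (auto simp only: l_def divide_less_eq_1_pos zero_less_divide_iff)
    define p where "p = l *\<^sub>R x"
    have "norm p = R" using l assms(4,5) by (auto simp: p_def l_def)
    then have "l * (G p \<bullet> x) \<le> 0" using boundary[of p] by (simp add: p_def)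
    then have 1: "G p \<bullet> x \<le> 0" using l by (simp add: mult_le_0_iff)
    have xp: "x - p = (1 - l) *\<^sub>R x" by (simp add: p_def algebra_simps)
    have "(1 - l) * (G x \<bullet> x) \<le> (1 - l) * (G p \<bullet> x)"
      using mono[of x p] unfolding xp by (simp add: inner_diff_left algebra_simps)
    also have "\<dots> \<le> 0" using 1 l by (intro mult_nonneg_nonpos) auto
    finally show ?thesis using l by (simp add: mult_le_0_iff)
  qed (use boundary in auto)
qed

lemma bounded_path_if_has_integral:
  fixes X :: "real \<Rightarrow> 'a::euclidean_space"
  assumes X: "\<And>t. a \<le> t \<Longrightarrow> (g has_integral (X t - x)) {a..t}"
  obtains B where "\<And>r. r \<in> {a..b} \<Longrightarrow> norm (X r) \<le> B"
proof -
  have "continuous_on {a..b} X" using X by (rule continuous_on_if_has_integral)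
  then have "bounded (X ` {a..b})"
    by (intro compact_imp_bounded compact_continuous_image) auto
  then show ?thesis using that unfolding bounded_iff by fastforce
qed

text \<open>After the last time \<open>s\<close> in the ball, the path stays where every field
  points inwards, so the contraction estimate with rate 0 forbids the norm to have grown since
  \<open>s\<close>.\<close>

lemma norm_le_if_inward:
  fixes X :: "real \<Rightarrow> 'a::euclidean_space"
  assumes X: "\<And>t. 0 \<le> t \<Longrightarrow> ((\<lambda>s. F (I s) (X s)) has_integral (X t - x)) {0..t}"
    and inward: "\<And>i z. norm z \<ge> R \<Longrightarrow> F i z \<bullet> z \<le> 0"
    and bdd: "\<And>r. \<exists>K. \<forall>i z. norm z \<le> r \<longrightarrow> norm (F i z) \<le> K"
    and "norm x \<le> R" "t \<ge> 0"
  shows "norm (X t) \<le> R"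
proof (rule ccontr)
  assume out: "\<not> norm (X t) \<le> R"
  have cont: "continuous_on {0..t} X" using X by (rule continuous_on_if_has_integral)
  have X0: "X 0 = x" using has_integral_unique[OF X[of 0]] has_integral_refl(1) by fastforce
  define S where "S = {s\<in>{0..t}. norm (X s) \<in> {..R}}"
  have "compact S"
  proof -
    have "closed ({0..t} \<inter> (\<lambda>s. norm (X s)) -` {..R})"
      by (intro continuous_closed_preimage continuous_on_norm cont) auto
    moreover have "S = {0..t} \<inter> ({0..t} \<inter> (\<lambda>s. norm (X s)) -` {..R})" by (auto simp: S_def)
    ultimately show ?thesis using compact_Int_closed[OF compact_Icc] by metis
  qed
  moreover have "0 \<in> S" using X0 assms(4,5) by (simp add: S_def)
  ultimately obtain s where s: "s \<in> S" and last: "\<And>r. r \<in> S \<Longrightarrow> r \<le> s"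
    using compact_attains_sup[of S] by auto
  have st: "0 \<le> s" "s \<le> t" "norm (X s) \<le> R" using s by (auto simp: S_def)
  have "continuous_on {s..t} (\<lambda>r. norm (X r))"
    by (intro continuous_on_norm continuous_on_subset[OF cont]) (use st in auto)
  then obtain r where r: "s \<le> r" "r \<le> t" "norm (X r) = R"
    using IVT'[of "\<lambda>r. norm (X r)" s R t] st out by auto
  then have "r \<in> S" using st by (simp add: S_def)
  \<comment> \<open>The intermediate value theorem puts the path on the sphere at some time from
    \<open>s\<close> on, and this time can only be \<open>s\<close>. Hence the inward condition
    holds on the whole closed interval \<open>{s..t}\<close>.\<close>
  then have Xs: "norm (X s) = R" using last r by force
  have outside: "norm (X r) \<ge> R" if "s \<le> r" "r \<le> t" for r
  proof (rule ccontr)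
    assume "\<not> norm (X r) \<ge> R"
    then have "r \<in> S" using that st by (simp add: S_def)
    then show False using last[of r] that Xs \<open>\<not> norm (X r) \<ge> R\<close> by simp
  qed
  obtain B where B: "\<And>r. r \<in> {0..t} \<Longrightarrow> norm (X r) \<le> B"
    using bounded_path_if_has_integral[OF X, of t] by blast
  obtain K where K: "\<And>i z. norm z \<le> B \<Longrightarrow> norm (F i z) \<le> K" using bdd by blast
  have "norm (X t) \<le> exp (- 0 * (t - s)) * norm (X s)"
  proof (rule norm_le_exp_if_dissipative[where g = "\<lambda>s. F (I s) (X s)" and K = K])
    show "((\<lambda>s. F (I s) (X s)) has_integral X b - X a) {a..b}"
      if "s \<le> a" "a \<le> b" for a b
      using that st by (intro has_integral_increments[OF X]) auto
  qed (use st B K outside inward in auto)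
  then show False using st out by simp
qed

section \<open>The environment: uniform transition bounds and avoided paths\<close>

text \<open>There is no periodicity in continuous time: the limit at 0 and a division of
  \<open>t\<close> into short steps make \<open>pmf (\<kappa> t i) i\<close> positive for all
  \<open>t\<close>. So a state \<open>j\<close> charged at time \<open>\<tau> i j\<close> is still
  charged at a later time \<open>h\<close> common to all pairs, and finiteness gives the minimum
  \<open>p\<close>.\<close>

lemma transition_lower_bound:
  fixes \<kappa> :: "real \<Rightarrow> 'e::finite \<Rightarrow> 'e pmf"
  assumes "transition_semigroup \<kappa>" "irreducible_semigroup \<kappa>"
  obtains h p where "h > 0" "p > 0" "\<And>i j. pmf (\<kappa> h i) j \<ge> p"
proof -
  have CK: "pmf (\<kappa> s i) k * pmf (\<kappa> t k) j \<le> pmf (\<kappa> (s + t) i) j" if "s \<ge> 0" "t \<ge> 0" for s t i j k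
  proof -
    have "pmf (\<kappa> (s + t) i) j = (\<Sum>l\<in>UNIV. pmf (\<kappa> s i) l * pmf (\<kappa> t l) j)"
      using assms(1) that by (simp add: transition_semigroup_def pmf_bind integral_measure_pmf[of UNIV])
    also have "\<dots> \<ge> pmf (\<kappa> s i) k * pmf (\<kappa> t k) j"
      by (rule member_le_sum) auto
    finally show ?thesis .
  qed
  have diag: "pmf (\<kappa> t i) i > 0" if t: "t \<ge> 0" for t i
  proof (cases "t = 0")
    case True
    then show ?thesis using assms(1) by (simp add: transition_semigroup_def)
  next
    case False
    have "((\<lambda>t. pmf (\<kappa> t i) i) \<longlongrightarrow> 1) (at_right 0)"
      using assms(1) unfolding transition_semigroup_def by (metis (full_types) of_bool_eq(2))
    then have "\<forall>\<^sub>F s in at_right 0. pmf (\<kappa> s i) i > 0"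
      by (rule order_tendstoD) simp
    then obtain d where d: "d > 0" "\<And>s. 0 < s \<Longrightarrow> s < d \<Longrightarrow> pmf (\<kappa> s i) i > 0"
      unfolding eventually_at_right_field by auto
    obtain n where n: "t < real n * d" using reals_Archimedean3[OF d(1)] by blast
    have n0: "n > 0" using n t by (cases n) auto
    have "pmf (\<kappa> (real m * (t / n)) i) i > 0" for m
    proof (induction m)
      case 0
      show ?case using assms(1) by (simp add: transition_semigroup_def)
    next
      case (Suc m)
      have "pmf (\<kappa> (t / n) i) i > 0"
        using n n0 t False by (intro d(2)) (auto simp: field_simps)
      then have "0 < pmf (\<kappa> (real m * (t / n)) i) i * pmf (\<kappa> (t / n) i) i"
        using Suc by simp
      also have "\<dots> \<le> pmf (\<kappa> (real m * (t / n) + t / n) i) i"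
        by (rule CK) (use t in auto)
      also have "real m * (t / n) + t / n = real (Suc m) * (t / n)"
        by (simp only: of_nat_Suc distrib_right mult_1_left add.commute)
      finally show ?case .
    qed
    from this[of n] show ?thesis using n0 by simp
  qed
  obtain \<tau> where \<tau>: "\<And>i j. \<tau> i j \<ge> 0" "\<And>i j. pmf (\<kappa> (\<tau> i j) i) j > 0"
    using assms(2) unfolding irreducible_semigroup_def by metis
  \<comment> \<open>The summand 1 keeps \<open>h\<close> positive even if all
    \<open>\<tau> i j\<close> are 0, as can happen with a single state.\<close>
  define h where "h = 1 + Max (range (\<lambda>(i, j). \<tau> i j))"
  have h: "\<tau> i j + 1 \<le> h" for i j
    unfolding h_def by (auto intro!: Max_ge)
  define p where "p = Min (range (\<lambda>(i, j). pmf (\<kappa> h i) j))"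
  have pos: "pmf (\<kappa> h i) j > 0" for i j
  proof -
    have "0 < pmf (\<kappa> (\<tau> i j) i) j * pmf (\<kappa> (h - \<tau> i j) j) j"
      using \<tau>[of i j] h[of i j] diag by simp
    also have "\<dots> \<le> pmf (\<kappa> (\<tau> i j + (h - \<tau> i j)) i) j"
      using \<tau>[of i j] h[of i j] by (intro CK) auto
    finally show ?thesis by simp
  qed
  show ?thesis
  proof
    show "h > 0" using h[of undefined undefined] \<tau>(1)[of undefined undefined] by linarith
    show "p > 0" unfolding p_def by (subst Min_gr_iff) (auto simp: pos)
    show "pmf (\<kappa> h i) j \<ge> p" for i j unfolding p_def by (rule Min_le) auto
  qed
qed

text \<open>Wherever the chain stands, the next value of \<open>e\<close> is hit with probability at
  least \<open>p\<close>. Time 0 yields no factor, whence the exponent \<open>n\<close> for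
  \<open>n + 1\<close> times. The chain is given by its finite-dimensional distributions, so the
  Markov step is carried out on cylinders \<open>C n a\<close>.\<close>

lemma prob_avoid_path_le:
  fixes \<kappa> :: "real \<Rightarrow> 'e::finite \<Rightarrow> 'e pmf"
  assumes mc: "markov_chain P \<kappa> j J" and h: "h \<ge> 0" and p: "\<And>i j. pmf (\<kappa> h i) j \<ge> p"
  shows "measure P {\<omega>\<in>space P. \<forall>k\<le>n. J (real k * h) \<omega> \<noteq> e k} \<le> (1 - p) ^ n"
proof (induction n)
  case 0
  interpret prob_space P using mc by (simp add: markov_chain_def)
  show ?case by simp
next
  case (Suc n)
  interpret prob_space P using mc by (simp add: markov_chain_def)
  have [measurable]: "J (real k * h) \<in> measurable P (count_space UNIV)" for k
    using mc h by (simp add: markov_chain_def)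
  define C where "C n a = {\<omega>\<in>space P. \<forall>k\<le>n. J (real k * h) \<omega> = a k}" for n and a :: "nat \<Rightarrow> 'e"
  have C[measurable]: "C n a \<in> sets P" for n a unfolding C_def by measurable
  have fdd: "measure P (C n a) = (\<Prod>k<n. pmf (\<kappa> h (a k)) (a (Suc k)))" if "a 0 = j" for n a
  proof -
    have "real (Suc k) * h - real k * h = h" for k by (simp add: algebra_simps)
    moreover have "mono_on {..n} (\<lambda>k. real k * h)" using h by (intro mono_onI mult_right_mono) auto
    moreover have "\<forall>n (\<tau> :: nat \<Rightarrow> real) e. \<tau> 0 = 0 \<longrightarrow> mono_on {..n} \<tau> \<longrightarrow> e 0 = j \<longrightarrow>
        measure P {\<omega>\<in>space P. \<forall>k\<le>n. J (\<tau> k) \<omega> = e k} =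
          (\<Prod>k<n. pmf (\<kappa> (\<tau> (Suc k) - \<tau> k) (e k)) (e (Suc k)))"
      using mc by (simp add: markov_chain_def)
    ultimately show ?thesis using that unfolding C_def by fastforce
  qed
  \<comment> \<open>The defining formula covers sequences that start from \<open>j\<close>; all
    others have cylinders disjoint from \<open>C 0 (\<lambda>_. j)\<close>, which has measure
    1.\<close>
  have null: "measure P (C n a) = 0" if "a 0 \<noteq> j" for n a
  proof -
    have "measure P (C n a) + measure P (C 0 (\<lambda>_. j)) = measure P (C n a \<union> C 0 (\<lambda>_. j))"
      using that by (intro finite_measure_Union[symmetric] C) (auto simp: C_def)
    also have "\<dots> \<le> 1" by simp
    finally show ?thesis using fdd[of "\<lambda>_. j" 0] measure_nonneg[of P "C n a"] by simp
  qed
  \<comment> \<open>Extensionality makes distinct elements differ at some \<open>k \<le> n\<close>,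
    so that their cylinders are disjoint.\<close>
  define A where "A = PiE {..n} (\<lambda>k. UNIV - {e k})"
  have finA: "finite A" unfolding A_def by (intro finite_PiE) auto
  have disj: "disjoint_family_on (C n) A"
    unfolding disjoint_family_on_def
  proof safe
    fix a b \<omega> assume ab: "a \<in> A" "b \<in> A" "a \<noteq> b" and "\<omega> \<in> C n a" "\<omega> \<in> C n b"
    then have "\<forall>k\<le>n. a k = b k" by (auto simp: C_def)
    then have "a = b" using ab unfolding A_def by (intro PiE_ext) auto
    with ab(3) show "\<omega> \<in> {}" by simp
  qed
  have Un: "{\<omega>\<in>space P. \<forall>k\<le>n. J (real k * h) \<omega> \<noteq> e k} = (\<Union>a\<in>A. C n a)"
  proof (intro equalityI subsetI)
    fix \<omega> assume "\<omega> \<in> {\<omega>\<in>space P. \<forall>k\<le>n. J (real k * h) \<omega> \<noteq> e k}"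
    then have "\<omega> \<in> C n (\<lambda>k\<in>{..n}. J (real k * h) \<omega>)" "(\<lambda>k\<in>{..n}. J (real k * h) \<omega>) \<in> A"
      by (auto simp: C_def A_def)
    then show "\<omega> \<in> (\<Union>a\<in>A. C n a)" by blast
  qed (auto simp: A_def C_def PiE_def Pi_def)
  have sumC: "measure P (\<Union>a\<in>A. C n a) = (\<Sum>a\<in>A. measure P (C n a))"
    using finA disj by (intro finite_measure_finite_Union) auto
  have step: "measure P (\<Union>b\<in>UNIV - {e (Suc n)}. C (Suc n) (a(Suc n := b))) \<le> (1 - p) * measure P (C n a)" for a
  proof (cases "a 0 = j")
    case True
    have "measure P (\<Union>b\<in>UNIV - {e (Suc n)}. C (Suc n) (a(Suc n := b)))
        \<le> (\<Sum>b\<in>UNIV - {e (Suc n)}. measure P (C (Suc n) (a(Suc n := b))))"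
      by (intro finite_measure_subadditive_finite) auto
    also have "\<dots> = (\<Sum>b\<in>UNIV - {e (Suc n)}. measure P (C n a) * pmf (\<kappa> h (a n)) b)"
      using True by (intro sum.cong refl) (simp add: fdd)
    also have "\<dots> = measure P (C n a) * (\<Sum>b\<in>UNIV - {e (Suc n)}. pmf (\<kappa> h (a n)) b)"
      by (simp add: sum_distrib_left)
    also have "(\<Sum>b\<in>UNIV - {e (Suc n)}. pmf (\<kappa> h (a n)) b) = 1 - pmf (\<kappa> h (a n)) (e (Suc n))"
      by (simp add: sum_diff1 sum_pmf_eq_1)
    also have "measure P (C n a) * (1 - pmf (\<kappa> h (a n)) (e (Suc n))) \<le> measure P (C n a) * (1 - p)"
      using p by (intro mult_left_mono) auto
    finally show ?thesis by (simp only: mult.commute)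
  next
    case False
    have "measure P (\<Union>b\<in>UNIV - {e (Suc n)}. C (Suc n) (a(Suc n := b)))
        \<le> (\<Sum>b\<in>UNIV - {e (Suc n)}. measure P (C (Suc n) (a(Suc n := b))))"
      by (intro finite_measure_subadditive_finite) auto
    also have "\<dots> = 0" using False by (intro sum.neutral) (auto intro!: null)
    finally show ?thesis using null[of a n] False by simp
  qed
  have "1 - p \<ge> 0" using p[of undefined undefined] pmf_le_1[of "\<kappa> h undefined" undefined] by linarith
  have "measure P {\<omega>\<in>space P. \<forall>k\<le>Suc n. J (real k * h) \<omega> \<noteq> e k}
      \<le> measure P (\<Union>a\<in>A. \<Union>b\<in>UNIV - {e (Suc n)}. C (Suc n) (a(Suc n := b)))"
  proof (intro finite_measure_mono subsetI)
    fix \<omega> assume \<omega>: "\<omega> \<in> {\<omega>\<in>space P. \<forall>k\<le>Suc n. J (real k * h) \<omega> \<noteq> e k}"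
    then have "\<omega> \<in> {\<omega>\<in>space P. \<forall>k\<le>n. J (real k * h) \<omega> \<noteq> e k}" by auto
    then obtain a where a: "a \<in> A" "\<omega> \<in> C n a" unfolding Un by blast
    then have "\<omega> \<in> C (Suc n) (a(Suc n := J (real (Suc n) * h) \<omega>))"
      by (auto simp: C_def le_Suc_eq)
    moreover have "J (real (Suc n) * h) \<omega> \<noteq> e (Suc n)" using \<omega> by blast
    ultimately show "\<omega> \<in> (\<Union>a\<in>A. \<Union>b\<in>UNIV - {e (Suc n)}. C (Suc n) (a(Suc n := b)))"
      using a(1) by blast
  qed (use finA in \<open>auto intro!: sets.finite_UN\<close>)
  also have "\<dots> \<le> (\<Sum>a\<in>A. measure P (\<Union>b\<in>UNIV - {e (Suc n)}. C (Suc n) (a(Suc n := b))))"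
    using finA by (intro finite_measure_subadditive_finite) auto
  also have "\<dots> \<le> (\<Sum>a\<in>A. (1 - p) * measure P (C n a))" by (intro sum_mono step)
  also have "\<dots> = (1 - p) * measure P {\<omega>\<in>space P. \<forall>k\<le>n. J (real k * h) \<omega> \<noteq> e k}"
    by (simp add: Un sumC sum_distrib_left)
  also have "\<dots> \<le> (1 - p) * (1 - p) ^ n" using Suc.IH \<open>1 - p \<ge> 0\<close> by (rule mult_left_mono)
  finally show ?case by simp
qed

section \<open>Measurability of time integrals\<close>

text \<open>Measurability at each fixed time does not yield the joint measurability that integration
  over time requires. Right-continuity does: \<open>f \<omega> s\<close> is the limit of the values
  at grid points \<open>q n s\<close>, which are countably many for fixed \<open>n\<close>.\<close>

lemma borel_measurable_integral_right_continuous: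
  fixes f :: "'w \<Rightarrow> real \<Rightarrow> real"
  assumes meas: "\<And>s. s \<ge> 0 \<Longrightarrow> (\<lambda>\<omega>. f \<omega> s) \<in> borel_measurable N"
    and rc: "\<And>\<omega> s. \<omega> \<in> space N \<Longrightarrow> s \<ge> 0 \<Longrightarrow> (f \<omega> \<longlongrightarrow> f \<omega> s) (at_right s)"
    and bdd: "\<And>\<omega> s. \<omega> \<in> space N \<Longrightarrow> s \<ge> 0 \<Longrightarrow> \<bar>f \<omega> s\<bar> \<le> B"
  shows "(\<lambda>\<omega>. integral {0..t} (f \<omega>)) \<in> borel_measurable N"
proof -
  \<comment> \<open>The \<open>+ 1\<close> puts \<open>q n s\<close> strictly to the right of
    \<open>s \<ge> 0\<close>, and \<open>nat\<close> keeps it positive for negative \<open>s\<close>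
    too, so that \<open>meas\<close> applies at every grid point.\<close>
  define q where "q n s = (real (nat \<lfloor>s * real (Suc n)\<rfloor>) + 1) / real (Suc n)" for n s
  have q: "s < q n s" "q n s \<le> s + 1 / real (Suc n)" if "s \<ge> 0" for n s
  proof -
    have "real (nat \<lfloor>s * real (Suc n)\<rfloor>) = of_int \<lfloor>s * real (Suc n)\<rfloor>"
      using that by (intro of_nat_nat) simp
    then have "s * real (Suc n) < real (nat \<lfloor>s * real (Suc n)\<rfloor>) + 1"
      "real (nat \<lfloor>s * real (Suc n)\<rfloor>) \<le> s * real (Suc n)"
      by linarith+
    then show "s < q n s" "q n s \<le> s + 1 / real (Suc n)"
      unfolding q_def
      by (simp_all only: pos_less_divide_eq pos_divide_le_eq of_nat_0_less_iff zero_less_Suc distrib_right)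
        simp  qed
  have q_lim: "filterlim (\<lambda>n. q n s) (at_right s) sequentially" if "s \<ge> 0" for s
    unfolding filterlim_at
  proof
    show "\<forall>\<^sub>F n in sequentially. q n s \<in> {s<..} \<and> q n s \<noteq> s"
      using q(1)[OF that] by (intro always_eventually allI) (simp add: less_imp_neq[symmetric])
    have "(\<lambda>n. s + inverse (real (Suc n))) \<longlonglongrightarrow> s + 0"
      by (rule tendsto_add[OF tendsto_const LIMSEQ_inverse_real_of_nat])
    then have up: "(\<lambda>n. s + 1 / real (Suc n)) \<longlonglongrightarrow> s" by (simp add: divide_inverse)
    have "\<forall>\<^sub>F n in sequentially. s \<le> q n s" "\<forall>\<^sub>F n in sequentially. q n s \<le> s + 1 / real (Suc n)"
      using q[OF that] by (simp_all add: less_imp_le del: of_nat_Suc)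
    then show "(\<lambda>n. q n s) \<longlonglongrightarrow> s"
      by (rule tendsto_sandwich[OF _ _ tendsto_const up])
  qed
  define g where "g z = indicator {0..t} (snd z) * f (fst z) (snd z)" for z
  have g[measurable]: "g \<in> borel_measurable (N \<Otimes>\<^sub>M lborel)"
  proof (rule borel_measurable_LIMSEQ_real)
    fix z assume z: "z \<in> space (N \<Otimes>\<^sub>M (lborel :: real measure))"
    show "(\<lambda>n. indicator {0..t} (snd z) * f (fst z) (q n (snd z))) \<longlonglongrightarrow> g z"
    proof (cases "snd z \<in> {0..t}")
      case True
      then have "(\<lambda>n. f (fst z) (q n (snd z))) \<longlonglongrightarrow> f (fst z) (snd z)"
        using z by (intro filterlim_compose[OF rc q_lim]) (auto simp: space_pair_measure)
      then show ?thesis using True by (simp add: g_def)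
    qed (simp add: g_def)
  next
    fix n
    have "(\<lambda>z. f (fst z) ((real m + 1) / real (Suc n))) \<in> borel_measurable (N \<Otimes>\<^sub>M lborel)" for m
      by (rule measurable_compose[OF measurable_fst meas]) simp
    moreover have "(\<lambda>z. nat \<lfloor>snd z * real (Suc n)\<rfloor>) \<in> measurable (N \<Otimes>\<^sub>M (lborel :: real measure)) (count_space UNIV)"
      by measurable
    ultimately have "(\<lambda>z. f (fst z) (q n (snd z))) \<in> borel_measurable (N \<Otimes>\<^sub>M lborel)"
      unfolding q_def by (rule measurable_compose_countable)
    then show "(\<lambda>z. indicator {0..t} (snd z) * f (fst z) (q n (snd z))) \<in> borel_measurable (N \<Otimes>\<^sub>M lborel)"
      by measurable
  qed
  have "(\<lambda>\<omega>. \<integral>s. g (\<omega>, s) \<partial>lborel) \<in> borel_measurable N"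
    by (rule lborel.borel_measurable_lebesgue_integral) simp
  moreover have "(\<integral>s. g (\<omega>, s) \<partial>lborel) = integral {0..t} (f \<omega>)" if \<omega>: "\<omega> \<in> space N" for \<omega>
  proof -
    have "integrable lborel (\<lambda>s. g (\<omega>, s))"
    proof (rule Bochner_Integration.integrable_bound)
      show "integrable lborel (\<lambda>s. B * indicator {0..t} s :: real)"
        by (intro integrable_mult_right integrable_real_indicator) (simp_all add: emeasure_lborel_Icc_eq)
      show "(\<lambda>s. g (\<omega>, s)) \<in> borel_measurable lborel" using g \<omega> by (rule measurable_Pair2)
      show "AE s in lborel. norm (g (\<omega>, s)) \<le> norm (B * indicator {0..t} s :: real)"
        using bdd[OF \<omega>] by (intro AE_I2) (force simp: g_def indicator_def)
    qed
    then have "set_integrable lborel {0..t} (f \<omega>)" by (simp add: set_integrable_def g_def)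
    from set_borel_integral_eq_integral(2)[OF this]
    show ?thesis by (simp add: set_lebesgue_integral_def g_def)
  qed
  ultimately show ?thesis by (simp cong: measurable_cong)
qed

section \<open>Independence under a weight\<close>

text \<open>Makes independence available for functionals such as the penalization, which are
  measurable for the sigma-algebra of a path without being written as explicit functions of
  it.\<close>

lemma (in prob_space) indep_var_vimage_algebra:
  assumes UV: "indep_var S U T V"
    and Z: "Z \<in> measurable (vimage_algebra (space M) U S) A"
    and W: "W \<in> measurable (vimage_algebra (space M) V T) B"
  shows "indep_var A Z B W"
proof -
  have U: "random_variable S U" and V: "random_variable T V"
    and ind: "indep_set (sigma_sets (space M) {U -` A \<inter> space M | A. A \<in> sets S})
      (sigma_sets (space M) {V -` A \<inter> space M | A. A \<in> sets T})"
    using UV unfolding indep_var_eq by auto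
  have sub: "sets (vimage_algebra (space M) U S) \<subseteq> events" "sets (vimage_algebra (space M) V T) \<subseteq> events"
    using U V by (auto intro!: sets.sigma_sets_subset simp: sets_vimage_algebra)
  have Zs: "sigma_sets (space M) {Z -` E \<inter> space M | E. E \<in> sets A} \<subseteq> sets (vimage_algebra (space M) U S)"
  proof -
    have "{Z -` E \<inter> space M | E. E \<in> sets A} \<subseteq> sets (vimage_algebra (space M) U S)"
      using measurable_sets[OF Z] by auto
    from sets.sigma_sets_subset[OF this] show ?thesis by simp
  qed
  have Ws: "sigma_sets (space M) {W -` E \<inter> space M | E. E \<in> sets B} \<subseteq> sets (vimage_algebra (space M) V T)"
  proof -
    have "{W -` E \<inter> space M | E. E \<in> sets B} \<subseteq> sets (vimage_algebra (space M) V T)"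
      using measurable_sets[OF W] by auto
    from sets.sigma_sets_subset[OF this] show ?thesis by simp
  qed
  have "random_variable A Z" "random_variable B W"
    using Z W sub unfolding measurable_def by auto
  moreover have "indep_set (sigma_sets (space M) {Z -` E \<inter> space M | E. E \<in> sets A})
      (sigma_sets (space M) {W -` E \<inter> space M | E. E \<in> sets B})"
    using ind Zs Ws unfolding indep_set_def sets_vimage_algebra
    by (elim indep_sets_mono_sets) (auto split: bool.split)
  ultimately show ?thesis unfolding indep_var_eq by blast
qed

text \<open>Conditionally on the first process, the path \<open>I\<close> is deterministic, so the bound \<open>q\<close> holds
  whatever weight \<open>Z\<close> the first process carries.\<close>

lemma (in prob_space) expectation_avoid_le:
  fixes I J :: "nat \<Rightarrow> 'a \<Rightarrow> 'e::finite" and Z :: "'a \<Rightarrow> real"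
  assumes UV: "indep_var S U T V"
    and Z: "Z \<in> borel_measurable (vimage_algebra (space M) U S)" "\<And>\<omega>. 0 \<le> Z \<omega>" "\<And>\<omega>. \<omega> \<in> space M \<Longrightarrow> Z \<omega> \<le> b"
    and I: "\<And>k. I k \<in> measurable (vimage_algebra (space M) U S) (count_space UNIV)"
    and J: "\<And>k. J k \<in> measurable (vimage_algebra (space M) V T) (count_space UNIV)"
    and q: "\<And>e. prob {\<omega>\<in>space M. \<forall>k\<le>n. J k \<omega> \<noteq> e k} \<le> q"
  shows "expectation (\<lambda>\<omega>. Z \<omega> * indicator {\<omega>\<in>space M. \<forall>k\<le>n. I k \<omega> \<noteq> J k \<omega>} \<omega>) \<le> q * expectation Z"
proof -
  \<comment> \<open>The vector of the first \<open>n + 1\<close> values of \<open>I\<close> ranges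
    over a finite set. On the event \<open>Ie e\<close> the chains fail to meet exactly on
    \<open>Je e\<close>, which concerns \<open>J\<close> alone.\<close>
  define A where "A = PiE {..n} (\<lambda>_. UNIV :: 'e set)"
  define Ie where "Ie e = {\<omega>\<in>space M. \<forall>k\<le>n. I k \<omega> = e k}" for e
  define Je where "Je e = {\<omega>\<in>space M. \<forall>k\<le>n. J k \<omega> \<noteq> e k}" for e
  have finA: "finite A" unfolding A_def by (intro finite_PiE) auto
  have Ie: "Ie e \<in> sets (vimage_algebra (space M) U S)" for e
  proof -
    note I[measurable]
    have "{\<omega>\<in>space (vimage_algebra (space M) U S). \<forall>k\<le>n. I k \<omega> = e k} \<in> sets (vimage_algebra (space M) U S)"
      by measurable
    then show ?thesis unfolding Ie_def space_vimage_algebra .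
  qed
  have Je: "Je e \<in> sets (vimage_algebra (space M) V T)" for e
  proof -
    note J[measurable]
    have "{\<omega>\<in>space (vimage_algebra (space M) V T). \<forall>k\<le>n. J k \<omega> \<noteq> e k} \<in> sets (vimage_algebra (space M) V T)"
      by measurable
    then show ?thesis unfolding Je_def space_vimage_algebra .
  qed
  have ZI: "(\<lambda>\<omega>. Z \<omega> * indicator (Ie e) \<omega>) \<in> borel_measurable (vimage_algebra (space M) U S)" for e
    by (intro borel_measurable_times borel_measurable_indicator Z(1) Ie)
  have JI: "(indicator (Je e) :: 'a \<Rightarrow> real) \<in> borel_measurable (vimage_algebra (space M) V T)" for e
    by (intro borel_measurable_indicator Je)
  have ind: "indep_var borel (\<lambda>\<omega>. Z \<omega> * indicator (Ie e) \<omega>) borel (indicator (Je e) :: 'a \<Rightarrow> real)" for e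
    by (rule indep_var_vimage_algebra[OF UV ZI JI])
  \<comment> \<open>Independence is quoted for one of its components, the measurability of
    \<open>Z\<close> on \<open>M\<close>.\<close>
  have intZ: "integrable M Z"
    by (rule integrable_const_bound[where B = b, OF _ indep_var_rv1[OF indep_var_vimage_algebra[OF UV Z(1) JI]]])
      (use Z(2,3) in \<open>auto intro!: AE_I2\<close>)
  have intZI: "integrable M (\<lambda>\<omega>. Z \<omega> * indicator (Ie e) \<omega>)" for e
  proof (rule integrable_const_bound[where B = b, OF _ indep_var_rv1[OF ind]])
    have "norm (Z \<omega> * indicator (Ie e) \<omega>) \<le> b" if "\<omega> \<in> space M" for \<omega>
      using Z(2)[of \<omega>] Z(3)[OF that] by (cases "\<omega> \<in> Ie e") auto
    then show "AE \<omega> in M. norm (Z \<omega> * indicator (Ie e) \<omega>) \<le> b" by (rule AE_I2)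
  qed
  have intJ: "integrable M (indicator (Je e) :: 'a \<Rightarrow> real)" for e
    by (rule integrable_const_bound[where B = 1, OF _ indep_var_rv2[OF ind]]) (simp add: indicator_def)
  have prod: "integrable M (\<lambda>\<omega>. Z \<omega> * indicator (Ie e) \<omega> * indicator (Je e) \<omega>)"
    "expectation (\<lambda>\<omega>. Z \<omega> * indicator (Ie e) \<omega> * indicator (Je e) \<omega>)
      = expectation (\<lambda>\<omega>. Z \<omega> * indicator (Ie e) \<omega>) * prob (Je e)" for e
  proof -
    show "integrable M (\<lambda>\<omega>. Z \<omega> * indicator (Ie e) \<omega> * indicator (Je e) \<omega>)"
      by (rule indep_var_integrable[OF ind[of e] intZI[of e] intJ[of e]])
    have "Je e \<inter> space M = Je e" unfolding Je_def by blast
    then show "expectation (\<lambda>\<omega>. Z \<omega> * indicator (Ie e) \<omega> * indicator (Je e) \<omega>)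
      = expectation (\<lambda>\<omega>. Z \<omega> * indicator (Ie e) \<omega>) * prob (Je e)"
      using indep_var_lebesgue_integral[OF ind[of e] intZI[of e] intJ[of e]] by simp
  qed
  \<comment> \<open>Exactly one \<open>e\<close> in \<open>A\<close> agrees with the observed
    values. Used below both with the indicator of \<open>Je e\<close> and with a constant
    \<open>c\<close>.\<close>
  have split: "(\<Sum>e\<in>A. indicator (Ie e) \<omega> * c e) = c (\<lambda>k\<in>{..n}. I k \<omega>)"
    if "\<omega> \<in> space M" for \<omega> and c :: "(nat \<Rightarrow> 'e) \<Rightarrow> real"
  proof -
    have "indicator (Ie e) \<omega> * c e = (if e = (\<lambda>k\<in>{..n}. I k \<omega>) then c e else 0)" if "e \<in> A" for e
    proof -
      have "\<omega> \<in> Ie e \<longleftrightarrow> e = (\<lambda>k\<in>{..n}. I k \<omega>)"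
      proof
        assume "\<omega> \<in> Ie e"
        then show "e = (\<lambda>k\<in>{..n}. I k \<omega>)"
          using \<open>e \<in> A\<close> unfolding A_def
          by (intro PiE_ext[of _ "{..n}" "\<lambda>_. UNIV"]) (simp_all add: Ie_def)
      qed (use \<open>\<omega> \<in> space M\<close> in \<open>simp add: Ie_def\<close>)
      then show ?thesis by (simp add: indicator_def)
    qed
    then have "(\<Sum>e\<in>A. indicator (Ie e) \<omega> * c e) = (\<Sum>e\<in>A. if e = (\<lambda>k\<in>{..n}. I k \<omega>) then c e else 0)"
      by (rule sum.cong[OF refl])
    also have "\<dots> = c (\<lambda>k\<in>{..n}. I k \<omega>)"
      using finA by (simp add: A_def)
    finally show ?thesis .
  qed
  have "expectation (\<lambda>\<omega>. Z \<omega> * indicator {\<omega>\<in>space M. \<forall>k\<le>n. I k \<omega> \<noteq> J k \<omega>} \<omega>)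
      = expectation (\<lambda>\<omega>. \<Sum>e\<in>A. Z \<omega> * indicator (Ie e) \<omega> * indicator (Je e) \<omega>)"
  proof (rule Bochner_Integration.integral_cong[OF refl])
    fix \<omega> assume \<omega>: "\<omega> \<in> space M"
    have "(\<Sum>e\<in>A. Z \<omega> * indicator (Ie e) \<omega> * indicator (Je e) \<omega>)
        = Z \<omega> * (\<Sum>e\<in>A. indicator (Ie e) \<omega> * indicator (Je e) \<omega>)"
      by (simp add: sum_distrib_left mult.assoc)
    also have "(\<Sum>e\<in>A. indicator (Ie e) \<omega> * indicator (Je e) \<omega>) = (indicator (Je (\<lambda>k\<in>{..n}. I k \<omega>)) \<omega> :: real)"
      by (rule split[OF \<omega>])
    also have "\<dots> = indicator {\<omega>\<in>space M. \<forall>k\<le>n. I k \<omega> \<noteq> J k \<omega>} \<omega>"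
      using \<omega> by (auto simp: Je_def indicator_def)
    finally show "Z \<omega> * indicator {\<omega>\<in>space M. \<forall>k\<le>n. I k \<omega> \<noteq> J k \<omega>} \<omega>
        = (\<Sum>e\<in>A. Z \<omega> * indicator (Ie e) \<omega> * indicator (Je e) \<omega>)" by simp
  qed
  also have "\<dots> = (\<Sum>e\<in>A. expectation (\<lambda>\<omega>. Z \<omega> * indicator (Ie e) \<omega>) * prob (Je e))"
    using prod by (simp add: Bochner_Integration.integral_sum)
  also have "\<dots> \<le> (\<Sum>e\<in>A. expectation (\<lambda>\<omega>. Z \<omega> * indicator (Ie e) \<omega>) * q)"
    using q Z(2) by (intro sum_mono mult_left_mono integral_nonneg_AE AE_I2) (auto simp: Je_def)
  also have "\<dots> = expectation (\<lambda>\<omega>. \<Sum>e\<in>A. Z \<omega> * indicator (Ie e) \<omega>) * q"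
    using intZI by (simp add: Bochner_Integration.integral_sum sum_distrib_right)
  also have "expectation (\<lambda>\<omega>. \<Sum>e\<in>A. Z \<omega> * indicator (Ie e) \<omega>) = expectation Z"
  proof (rule Bochner_Integration.integral_cong[OF refl])
    fix \<omega> assume \<omega>: "\<omega> \<in> space M"
    show "(\<Sum>e\<in>A. Z \<omega> * indicator (Ie e) \<omega>) = Z \<omega>"
      using split[OF \<omega>, of "\<lambda>_. Z \<omega>"] by (simp add: mult.commute)
  qed
  finally show ?thesis by (simp add: mult.commute)
qed

section \<open>Switched trajectories, their coupling and the penalization\<close>

lemma meeting_time_le: "0 \<le> s \<Longrightarrow> I s \<omega> = J s \<omega> \<Longrightarrow> meeting_time I J \<omega> \<le> ereal s"
  unfolding meeting_time_def by (rule INF_lower) simp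

lemma meeting_time_nonneg: "0 \<le> meeting_time I J \<omega>"
  unfolding meeting_time_def by (rule INF_greatest) simp

lemma measurable_path_components:
  fixes X :: "real \<Rightarrow> 'w \<Rightarrow> 'a::topological_space" and I :: "real \<Rightarrow> 'w \<Rightarrow> 'e" and \<Omega> :: "'w set"
  assumes "t \<ge> 0"
  defines "N \<equiv> vimage_algebra \<Omega> (\<lambda>\<omega>. \<lambda>t\<in>{0..}. (X t \<omega>, I t \<omega>))
    (PiM {0..} (\<lambda>_. borel \<Otimes>\<^sub>M count_space UNIV))"
  shows "X t \<in> borel_measurable N" "I t \<in> measurable N (count_space UNIV)"
proof -
  have "(\<lambda>\<omega>. \<lambda>t\<in>{0..}. (X t \<omega>, I t \<omega>)) \<in> measurable N (PiM {0..} (\<lambda>_. borel \<Otimes>\<^sub>M count_space UNIV))"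
    unfolding N_def by (intro measurable_vimage_algebra1) (auto simp: space_PiM space_pair_measure)
  from measurable_compose[OF this measurable_component_singleton, of t]
  have XI: "(\<lambda>\<omega>. (X t \<omega>, I t \<omega>)) \<in> measurable N (borel \<Otimes>\<^sub>M count_space UNIV)"
    using assms(1) by simp
  show "X t \<in> borel_measurable N" using measurable_compose[OF XI measurable_fst] by simp
  show "I t \<in> measurable N (count_space UNIV)" using measurable_compose[OF XI measurable_snd] by simp
qed

text \<open>The invariance of the ball under the flows enters in the form \<open>inward\<close>,
  which applies to a path whose field keeps changing.\<close>

locale switched_system =
  fixes F :: "'e::finite \<Rightarrow> real^'k \<Rightarrow> real^'k"
    and \<rho> :: "(real^'k) \<times> 'e \<Rightarrow> real"
    and \<gamma> R L :: real
  assumes \<gamma>: "\<gamma> > 0" and R: "R > 0"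
    and dissipative: "\<And>i x y. (F i x - F i y) \<bullet> (x - y) \<le> - \<gamma> * (norm (x - y))\<^sup>2"
    and inward: "\<And>i x. norm x \<ge> R \<Longrightarrow> F i x \<bullet> x \<le> 0"
    and \<rho>_nonneg: "\<And>u. u \<in> cball 0 R \<times> UNIV \<Longrightarrow> \<rho> u \<ge> 0"
    and \<rho>_lipschitz: "\<And>u v. u \<in> cball 0 R \<times> UNIV \<Longrightarrow> v \<in> cball 0 R \<times> UNIV \<Longrightarrow>
      \<bar>\<rho> u - \<rho> v\<bar> \<le> L * switched_dist R u v"
begin

lemma switched_dist_nonneg: "switched_dist R u v \<ge> 0"
  using R by (simp add: switched_dist_def)

lemma switched_dist_le_1:
  assumes "norm (fst u - fst v) \<le> 2 * R"
  shows "switched_dist R u v \<le> 1"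
  using R assms by (simp add: switched_dist_def)

lemma vector_fields_bounded: "\<exists>K. \<forall>i z. norm z \<le> r \<longrightarrow> norm (F i z) \<le> K"
proof -
  have "\<exists>K. \<forall>z. norm z \<le> r \<longrightarrow> norm (F i z) \<le> K" for i
  proof -
    have "(F i x - F i y) \<bullet> (x - y) \<le> 0" for x y
      using dissipative[of i x y] \<gamma> by (smt (verit) mult_minus_left mult_nonneg_nonneg zero_le_power2)
    then show ?thesis using monotone_bounded_on_cball[of "F i" r] by blast
  qed
  then obtain K where K: "\<And>i z. norm z \<le> r \<Longrightarrow> norm (F i z) \<le> K i" by metis
  have "norm (F i z) \<le> Max (range K)" if "norm z \<le> r" for i z
    using K[OF that] by (rule order_trans) simp
  then show ?thesis by blast
qed

lemma trajectory_in_cball: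
  fixes X :: "real \<Rightarrow> real^'k" and I :: "real \<Rightarrow> 'e"
  assumes "\<And>t. 0 \<le> t \<Longrightarrow> ((\<lambda>s. F (I s) (X s)) has_integral (X t - x)) {0..t}"
    and "norm x \<le> R" "t \<ge> 0"
  shows "norm (X t) \<le> R"
  using norm_le_if_inward[of F I X x R t] assms inward vector_fields_bounded by blast

text \<open>At each time both positions are driven by the field with the same index
  \<open>I s\<close>, so dissipativity of the single fields governs their difference whatever the
  switching path. In the application \<open>T\<close> is the meeting time and \<open>y\<close> is
  the position of the second process there.\<close>

lemma trajectories_contract:
  fixes X Y :: "real \<Rightarrow> real^'k" and I :: "real \<Rightarrow> 'e"
  assumes X: "\<And>t. 0 \<le> t \<Longrightarrow> ((\<lambda>s. F (I s) (X s)) has_integral (X t - x)) {0..t}"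
    and Y: "\<And>t. T \<le> t \<Longrightarrow> ((\<lambda>s. F (I s) (Y s)) has_integral (Y t - y)) {T..t}"
    and t: "0 \<le> T" "T \<le> t"
  shows "norm (X t - Y t) \<le> exp (- \<gamma> * (t - T)) * norm (X T - y)"
proof -
  have "Y T = y" using has_integral_unique[OF Y[of T]] has_integral_refl(1) by fastforce
  obtain B where B: "\<And>r. r \<in> {0..t} \<Longrightarrow> norm (X r) \<le> B"
    using bounded_path_if_has_integral[OF X, of t] by blast
  obtain B' where B': "\<And>r. r \<in> {T..t} \<Longrightarrow> norm (Y r) \<le> B'"
    using bounded_path_if_has_integral[OF Y, of t] by blast
  obtain K where K: "\<And>i z. norm z \<le> max B B' \<Longrightarrow> norm (F i z) \<le> K"
    using vector_fields_bounded by blast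
  have "norm (X t - Y t) \<le> exp (- \<gamma> * (t - T)) * norm (X T - Y T)"
  proof (rule norm_le_exp_if_dissipative[where g = "\<lambda>s. F (I s) (X s) - F (I s) (Y s)" and K = "K + K"])
    show "((\<lambda>s. F (I s) (X s) - F (I s) (Y s)) has_integral (X b - Y b - (X a - Y a))) {a..b}"
      if "T \<le> a" "a \<le> b" for a b
    proof -
      have "((\<lambda>s. F (I s) (X s) - F (I s) (Y s)) has_integral ((X b - X a) - (Y b - Y a))) {a..b}"
        using that t by (intro has_integral_diff has_integral_increments[OF X] has_integral_increments[OF Y]) auto
      then show ?thesis by (simp add: algebra_simps)
    qed
    show "norm (F (I r) (X r) - F (I r) (Y r)) \<le> K + K" if "T \<le> r" "r \<le> t" for r
    proof -
      have "norm (F (I r) (X r)) \<le> K" "norm (F (I r) (Y r)) \<le> K"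
        using B[of r] B'[of r] that t by (auto intro!: K)
      then show ?thesis using norm_triangle_ineq4[of "F (I r) (X r)" "F (I r) (Y r)"] by linarith
    qed
  qed (use t \<gamma> dissipative in auto)
  then show ?thesis by (simp add: \<open>Y T = y\<close>)
qed

lemma \<rho>_continuous_on: "continuous_on (cball 0 R) (\<lambda>z. \<rho> (z, i))"
proof (rule lipschitz_on_continuous_on)
  show "(\<bar>L\<bar> / (2 * R))-lipschitz_on (cball 0 R) (\<lambda>z. \<rho> (z, i))"
  proof (rule lipschitz_onI)
    fix z w :: "real^'k" assume "z \<in> cball 0 R" "w \<in> cball 0 R"
    then have "\<bar>\<rho> (z, i) - \<rho> (w, i)\<bar> \<le> L * switched_dist R (z, i) (w, i)"
      by (intro \<rho>_lipschitz) auto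
    also have "\<dots> \<le> \<bar>L\<bar> * switched_dist R (z, i) (w, i)"
      by (intro mult_right_mono switched_dist_nonneg) simp
    finally show "dist (\<rho> (z, i)) (\<rho> (w, i)) \<le> \<bar>L\<bar> / (2 * R) * dist z w"
      by (simp add: dist_norm switched_dist_def)
  qed (use R in simp)
qed

lemma \<rho>_bounded: "\<exists>B. \<forall>u\<in>cball 0 R \<times> UNIV. \<bar>\<rho> u\<bar> \<le> B"
proof -
  have "\<bar>\<rho> u\<bar> \<le> \<bar>\<rho> (0, undefined)\<bar> + \<bar>L\<bar>" if "u \<in> cball 0 R \<times> UNIV" for u
  proof -
    have "\<bar>\<rho> u - \<rho> (0, undefined)\<bar> \<le> L * switched_dist R u (0, undefined)"
      using that R by (intro \<rho>_lipschitz) auto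
    also have "\<dots> \<le> \<bar>L\<bar> * switched_dist R u (0, undefined)"
      by (intro mult_right_mono switched_dist_nonneg) simp
    also have "\<dots> \<le> \<bar>L\<bar> * 1"
      using that R by (intro mult_left_mono switched_dist_le_1) auto
    finally show ?thesis by simp
  qed
  then show ?thesis by blast
qed

text \<open>Measurability for the sigma-algebra of \<open>(X, I)\<close>, and not just on
  \<open>P\<close>, is what makes the weight independent of \<open>J'\<close>. The integrand is
  right-continuous because \<open>X\<close> is continuous and \<open>I\<close> is constant just
  after each time.\<close>

lemma penalization_measurable:
  fixes P :: "'w measure"
  assumes sp: "switched_process P \<kappa> F u X I" and u: "norm (fst u) \<le> R"
  defines "N \<equiv> vimage_algebra (space P) (\<lambda>\<omega>. \<lambda>t\<in>{0..}. (X t \<omega>, I t \<omega>))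
    (PiM {0..} (\<lambda>_. borel \<Otimes>\<^sub>M count_space UNIV))"
  shows "penalization \<rho> X I t \<in> borel_measurable N"
proof -
  have spN: "space N = space P" by (simp add: N_def)
  have ode: "\<And>\<omega> t. \<omega> \<in> space P \<Longrightarrow> 0 \<le> t \<Longrightarrow>
      ((\<lambda>s. F (I s \<omega>) (X s \<omega>)) has_integral (X t \<omega> - fst u)) {0..t}"
    and cadlag: "\<And>\<omega>. \<omega> \<in> space P \<Longrightarrow> cadlag_path (\<lambda>t. I t \<omega>)"
    using sp by (auto simp: switched_process_def markov_chain_def)
  have X_in: "X s \<omega> \<in> cball 0 R" if "\<omega> \<in> space P" "s \<ge> 0" for \<omega> s
    using trajectory_in_cball[OF ode[OF that(1)] u that(2)] by simp
  obtain B where B: "\<And>u. u \<in> cball 0 R \<times> UNIV \<Longrightarrow> \<bar>\<rho> u\<bar> \<le> B" using \<rho>_bounded by blast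
  have "(\<lambda>\<omega>. integral {0..t} (\<lambda>s. \<rho> (X s \<omega>, I s \<omega>))) \<in> borel_measurable N"
  proof (rule borel_measurable_integral_right_continuous)
    fix s :: real assume s: "s \<ge> 0"
    have XI: "X s \<in> borel_measurable N" "I s \<in> measurable N (count_space UNIV)"
      unfolding N_def using measurable_path_components[OF s] by blast+
    \<comment> \<open>\<open>\<rho>\<close> may fail to be measurable outside the ball, hence the projection.\<close>
    have "continuous_on UNIV (\<lambda>z. \<rho> (closest_point (cball 0 R) z, i))" for i
      by (rule continuous_on_compose2[OF \<rho>_continuous_on continuous_on_closest_point])
        (use R in \<open>auto simp del: mem_cball intro!: closest_point_in_set\<close>)
    then have "(\<lambda>\<omega>. \<rho> (closest_point (cball 0 R) (X s \<omega>), i)) \<in> borel_measurable N" for i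
      by (intro measurable_compose[OF XI(1)] borel_measurable_continuous_onI)
    then have "(\<lambda>\<omega>. \<rho> (closest_point (cball 0 R) (X s \<omega>), I s \<omega>)) \<in> borel_measurable N"
      using XI(2) by (rule measurable_compose_countable)
    then show "(\<lambda>\<omega>. \<rho> (X s \<omega>, I s \<omega>)) \<in> borel_measurable N"
      using X_in[OF _ s] spN by (subst measurable_cong) (auto simp: closest_point_self)
  next
    fix \<omega> s assume \<omega>: "\<omega> \<in> space N" and s: "(s::real) \<ge> 0"
    have "continuous_on {0..s+1} (\<lambda>s. X s \<omega>)"
      using ode \<omega> spN by (intro continuous_on_if_has_integral) auto
    then have "continuous_on {s..s+1} (\<lambda>s. X s \<omega>)"
      by (rule continuous_on_subset) (use s in auto)
    then have X: "((\<lambda>s. X s \<omega>) \<longlongrightarrow> X s \<omega>) (at_right s)"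
      by (rule continuous_on_Icc_at_rightD) simp
    have "((\<lambda>r. \<rho> (X r \<omega>, I s \<omega>)) \<longlongrightarrow> \<rho> (X s \<omega>, I s \<omega>)) (at_right s)"
    proof (rule continuous_on_tendsto_compose[OF \<rho>_continuous_on X])
      show "X s \<omega> \<in> cball 0 R" using \<omega> spN s by (intro X_in) auto
      show "\<forall>\<^sub>F r in at_right s. X r \<omega> \<in> cball 0 R"
        using eventually_at_right_less[of s]
        by eventually_elim (rule X_in, use \<omega> spN s in auto)
    qed
    moreover have "\<forall>\<^sub>F r in at_right s. I r \<omega> = I s \<omega>"
      using cadlag[of \<omega>] \<omega> spN s unfolding cadlag_path_def by blast
    then have "\<forall>\<^sub>F r in at_right s. \<rho> (X r \<omega>, I s \<omega>) = \<rho> (X r \<omega>, I r \<omega>)"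
      by eventually_elim simp
    ultimately show "((\<lambda>r. \<rho> (X r \<omega>, I r \<omega>)) \<longlongrightarrow> \<rho> (X s \<omega>, I s \<omega>)) (at_right s)"
      by (rule Lim_transform_eventually)
    show "\<bar>\<rho> (X s \<omega>, I s \<omega>)\<bar> \<le> B"
      using X_in[of \<omega> s] \<omega> spN s by (intro B) auto
  qed
  then show ?thesis unfolding penalization_def[abs_def] by measurable
qed

lemma penalization_le_1:
  assumes sp: "switched_process P \<kappa> F u X I" and u: "norm (fst u) \<le> R"
    and "\<omega> \<in> space P"
  shows "penalization \<rho> X I t \<omega> \<le> 1"
proof -
  have "integral {0..t} (\<lambda>s. \<rho> (X s \<omega>, I s \<omega>)) \<ge> 0"
  \<comment> \<open>If the integrand is not integrable along the path, the integral is 0 by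
    convention, and the bound persists.\<close>
  proof (cases "(\<lambda>s. \<rho> (X s \<omega>, I s \<omega>)) integrable_on {0..t}")
    case True
    have "norm (X s \<omega>) \<le> R" if "s \<ge> 0" for s
      using trajectory_in_cball[of "\<lambda>t. I t \<omega>" "\<lambda>t. X t \<omega>" "fst u" s] sp assms(2,3) that
      by (auto simp: switched_process_def)
    then show ?thesis using True by (intro integral_nonneg) (auto intro!: \<rho>_nonneg)
  qed (simp add: not_integrable_integral)
  then show ?thesis by (simp add: penalization_def)
qed

text \<open>The two terms are the costs of not meeting by time \<open>t / 2\<close> and of
  contracting only from then on; hence the rate \<open>\<gamma> / 2\<close>.\<close>

lemma weighted_distance_le:
  fixes P :: "'w measure"
  assumes coupled: "coupled_process P \<kappa> F u v X I Y J"
    and u: "norm (fst u) \<le> R" and v: "norm (fst v) \<le> R" and t: "t \<ge> 0"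
    and h: "h > 0" and p: "\<And>i j. pmf (\<kappa> h i) j \<ge> p"
  shows "(\<integral>\<omega>. penalization \<rho> X I t \<omega> / (\<integral>\<omega>'. penalization \<rho> X I t \<omega>' \<partial>P)
                   * switched_dist R (X t \<omega>, I t \<omega>) (Y t \<omega>, J t \<omega>) \<partial>P)
    \<le> ((1 - p) ^ nat \<lfloor>t / (2 * h)\<rfloor> + exp (- (\<gamma> / 2) * t)) * switched_dist R u v"
proof -
  obtain Y' J' where X: "switched_process P \<kappa> F u X I" and Y': "switched_process P \<kappa> F v Y' J'"
    and indep: "indep_processes P (\<lambda>t \<omega>. (X t \<omega>, I t \<omega>)) (\<lambda>t \<omega>. (Y' t \<omega>, J' t \<omega>))"
    and Y: "\<And>\<omega> t. \<omega> \<in> space P \<Longrightarrow> 0 \<le> t \<Longrightarrow>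
           let T0 = meeting_time I J' \<omega>; T = real_of_ereal T0 in
             J t \<omega> = (if T0 > ereal t then J' t \<omega> else I t \<omega>) \<and>
             (if T0 > ereal t then Y t \<omega> = Y' t \<omega>
              else ((\<lambda>s. F (I s \<omega>) (Y s \<omega>)) has_integral (Y t \<omega> - Y' T \<omega>)) {T..t})"
    using coupled unfolding coupled_process_def by blast
  define T0 where "T0 = meeting_time I J'"
  interpret prob_space P using X by (simp add: switched_process_def markov_chain_def)
  have X_ode: "((\<lambda>s. F (I s \<omega>) (X s \<omega>)) has_integral (X t \<omega> - fst u)) {0..t}"
    and Y'_ode: "((\<lambda>s. F (J' s \<omega>) (Y' s \<omega>)) has_integral (Y' t \<omega> - fst v)) {0..t}"
    if "\<omega> \<in> space P" "t \<ge> 0" for \<omega> t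
    using X Y' that by (auto simp: switched_process_def)
  have X_in: "norm (X t \<omega>) \<le> R" and Y'_in: "norm (Y' t \<omega>) \<le> R" if "\<omega> \<in> space P" "t \<ge> 0" for \<omega> t
    using trajectory_in_cball[OF X_ode[OF that(1)] u that(2)] trajectory_in_cball[OF Y'_ode[OF that(1)] v that(2)]
    by auto
  have XY': "norm (X s \<omega> - Y' s \<omega>) \<le> 2 * R" if "\<omega> \<in> space P" "s \<ge> 0" for \<omega> s
    using X_in[OF that] Y'_in[OF that] norm_triangle_ineq4[of "X s \<omega>" "Y' s \<omega>"] by linarith
  have unmet: "J t \<omega> = J' t \<omega>" "Y t \<omega> = Y' t \<omega>" if "\<omega> \<in> space P" "\<not> T0 \<omega> \<le> ereal t" for \<omega>
    using Y[OF that(1) t] that(2) by (auto simp: T0_def Let_def)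
  have met: "J t \<omega> = I t \<omega> \<and> (\<exists>T. T0 \<omega> = ereal T \<and> 0 \<le> T \<and> T \<le> t \<and>
      norm (X t \<omega> - Y t \<omega>) \<le> exp (- \<gamma> * (t - T)) * norm (X T \<omega> - Y' T \<omega>))"
    if \<omega>: "\<omega> \<in> space P" and le: "T0 \<omega> \<le> ereal t" for \<omega>
  proof -
    have "0 \<le> T0 \<omega>" by (simp add: T0_def meeting_time_nonneg)
    then obtain T where T: "T0 \<omega> = ereal T" "0 \<le> T" "T \<le> t" using le by (cases "T0 \<omega>") auto
    have "((\<lambda>s. F (I s \<omega>) (Y s \<omega>)) has_integral (Y s \<omega> - Y' T \<omega>)) {T..s}" if "T \<le> s" for s
      using Y[OF \<omega>, of s] T that by (auto simp: Let_def simp flip: T0_def)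
    then have "norm (X t \<omega> - Y t \<omega>) \<le> exp (- \<gamma> * (t - T)) * norm (X T \<omega> - Y' T \<omega>)"
      using T X_ode[OF \<omega>] by (intro trajectories_contract[where I = "\<lambda>s. I s \<omega>"]) auto
    moreover have "J t \<omega> = I t \<omega>" using Y[OF \<omega> t] le by (auto simp: Let_def T0_def)
    ultimately show ?thesis using T by blast
  qed
  define d where "d \<omega> = switched_dist R (X t \<omega>, I t \<omega>) (Y t \<omega>, J t \<omega>)" for \<omega>
  define Z where "Z = penalization \<rho> X I t"
  define S :: "(real \<Rightarrow> (real^'k) \<times> 'e) measure" where
    "S = PiM {0..} (\<lambda>_. borel \<Otimes>\<^sub>M count_space UNIV)"
  define U where "U \<omega> = (\<lambda>t\<in>{0..}. (X t \<omega>, I t \<omega>))" for \<omega>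
  define V where "V \<omega> = (\<lambda>t\<in>{0..}. (Y' t \<omega>, J' t \<omega>))" for \<omega>
  have UV: "indep_var S U S V"
    using indep unfolding indep_processes_def S_def U_def[abs_def] V_def[abs_def] .
  have Z_meas: "Z \<in> borel_measurable (vimage_algebra (space P) U S)"
    unfolding Z_def S_def U_def[abs_def] by (rule penalization_measurable[OF X u])
  have Z_pos: "0 \<le> Z \<omega>" for \<omega> by (simp add: Z_def penalization_def)
  have Z_le: "Z \<omega> \<le> 1" if "\<omega> \<in> space P" for \<omega>
    unfolding Z_def by (rule penalization_le_1[OF X u that])
  have intZ: "integrable P Z"
    using indep_var_rv1[OF indep_var_vimage_algebra[OF UV Z_meas, of "\<lambda>_. 0" borel]] Z_pos Z_le
    by (intro integrable_const_bound[where B = 1]) auto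
  define EZ where "EZ = expectation Z"
  have EZ: "EZ \<ge> 0" unfolding EZ_def using Z_pos by (intro integral_nonneg_AE) auto
  have goal_eq: "(\<integral>\<omega>. penalization \<rho> X I t \<omega> / (\<integral>\<omega>'. penalization \<rho> X I t \<omega>' \<partial>P)
      * switched_dist R (X t \<omega>, I t \<omega>) (Y t \<omega>, J t \<omega>) \<partial>P) = expectation (\<lambda>\<omega>. Z \<omega> / EZ * d \<omega>)"
    by (simp add: Z_def EZ_def d_def)
  have q0: "(1 - p) ^ n \<ge> 0" for n :: nat
    using p[of undefined undefined] pmf_le_1[of "\<kappa> h undefined" undefined] by (intro zero_le_power) linarith
  show ?thesis
  proof (cases "snd u = snd v")
    case True
    \<comment> \<open>The case of a single time in the finite-dimensional distributions; it fixes
      the initial state only almost surely, so the comparison of distances below is almost sure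
      too.\<close>
    have start: "AE \<omega> in P. K 0 \<omega> = snd w" if "switched_process P \<kappa> F w W K" for w W K
    proof -
      have mc: "markov_chain P \<kappa> (snd w) K" using that by (simp add: switched_process_def)
      then have "\<forall>n (\<tau> :: nat \<Rightarrow> real) e. \<tau> 0 = 0 \<longrightarrow> mono_on {..n} \<tau> \<longrightarrow> e 0 = snd w \<longrightarrow>
          prob {\<omega>\<in>space P. \<forall>k\<le>n. K (\<tau> k) \<omega> = e k} =
            (\<Prod>k<n. pmf (\<kappa> (\<tau> (Suc k) - \<tau> k) (e k)) (e (Suc k)))"
        by (simp add: markov_chain_def)
      from this[rule_format, of "\<lambda>_. 0" 0 "\<lambda>_. snd w"]
      have "prob {\<omega>\<in>space P. K 0 \<omega> = snd w} = 1" by (simp add: mono_on_def)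
      moreover have "K 0 \<in> measurable P (count_space UNIV)" using mc by (simp add: markov_chain_def)
      then have "{\<omega>\<in>space P. K 0 \<omega> = snd w} \<in> events" by measurable
      ultimately show ?thesis by (subst (asm) prob_Collect_eq_1) auto
    qed
    have "AE \<omega> in P. d \<omega> \<le> exp (- \<gamma> * t) * switched_dist R u v"
      using start[OF X] start[OF Y'] AE_space
    proof eventually_elim
      case (elim \<omega>)
      have "T0 \<omega> \<le> ereal 0" unfolding T0_def using elim True by (intro meeting_time_le) auto
      moreover then have "T0 \<omega> \<le> ereal t" using t order_trans by fastforce
      ultimately have "J t \<omega> = I t \<omega>" "norm (X t \<omega> - Y t \<omega>) \<le> exp (- \<gamma> * t) * norm (X 0 \<omega> - Y' 0 \<omega>)"
        using met[OF elim(3)] by (auto simp: antisym)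
      moreover have "X 0 \<omega> = fst u" "Y' 0 \<omega> = fst v"
        using has_integral_unique[OF X_ode[OF elim(3), of 0]] has_integral_unique[OF Y'_ode[OF elim(3), of 0]]
          has_integral_refl(1) by fastforce+
      ultimately show ?case using R True by (simp add: d_def switched_dist_def divide_right_mono)
    qed
    \<comment> \<open>Only the dominating function has to be integrable: otherwise the left side
      would be 0 by convention.\<close>
    then have "expectation (\<lambda>\<omega>. Z \<omega> / EZ * d \<omega>) \<le> expectation (\<lambda>\<omega>. Z \<omega> / EZ * (exp (- \<gamma> * t) * switched_dist R u v))"
      using intZ EZ Z_pos switched_dist_nonneg[of u v]
      by (intro integral_mono_AE') (auto elim!: eventually_mono intro!: divide_right_mono mult_left_mono)
    also have "\<dots> = EZ / EZ * (exp (- \<gamma> * t) * switched_dist R u v)"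
      by (simp add: EZ_def)
    \<comment> \<open>\<open>EZ / EZ \<le> 1\<close> holds for every \<open>EZ\<close>, division by
      0 being 0.\<close>
    also have "\<dots> \<le> 1 * (exp (- \<gamma> * t) * switched_dist R u v)"
      using switched_dist_nonneg[of u v] by (intro mult_right_mono) auto
    also have "exp (- \<gamma> * t) \<le> exp (- (\<gamma> / 2) * t)" using \<gamma> t by simp
    also have "exp (- (\<gamma> / 2) * t) \<le> (1 - p) ^ nat \<lfloor>t / (2 * h)\<rfloor> + exp (- (\<gamma> / 2) * t)" using q0 by simp
    finally show ?thesis
      unfolding goal_eq using switched_dist_nonneg[of u v] by (simp add: mult_right_mono)
  next
    case False
    \<comment> \<open>Rounding down places all grid times \<open>0, h, ..., n h\<close> in
      \<open>{0..t/2}\<close>.\<close>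
    define n where "n = nat \<lfloor>t / (2 * h)\<rfloor>"
    have nh: "real n * h \<le> t / 2"
    proof -
      have "real n \<le> t / (2 * h)" using t h by (simp add: n_def)
      then have "real n * h \<le> t / (2 * h) * h" using h by (intro mult_right_mono) auto
      then show ?thesis using h by simp
    qed
    define A where "A = {\<omega>\<in>space P. \<forall>k\<le>n. I (real k * h) \<omega> \<noteq> J' (real k * h) \<omega>}"
    have d_le: "d \<omega> \<le> indicator A \<omega> + exp (- (\<gamma> / 2) * t)" if \<omega>: "\<omega> \<in> space P" for \<omega>
    proof (cases "\<omega> \<in> A")
      case True
      \<comment> \<open>The chains may have met by time \<open>t\<close> without agreeing on the
        grid. Then \<open>Y\<close> is controlled through its distance to \<open>X\<close>, which is
        at most the distance from \<open>X T\<close> to \<open>Y' T\<close>, two points of the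
        ball.\<close>
      have "norm (X t \<omega> - Y t \<omega>) \<le> 2 * R"
      proof (cases "T0 \<omega> \<le> ereal t")
        case True
        then obtain T where T: "0 \<le> T" "T \<le> t"
          "norm (X t \<omega> - Y t \<omega>) \<le> exp (- \<gamma> * (t - T)) * norm (X T \<omega> - Y' T \<omega>)"
          using met[OF \<omega>] by blast
        have "exp (- \<gamma> * (t - T)) * norm (X T \<omega> - Y' T \<omega>) \<le> 1 * (2 * R)" using T \<gamma> XY'[OF \<omega> T(1)] by (intro mult_mono) auto
        with T(3) show ?thesis by simp
      qed (use unmet[OF \<omega>] XY'[OF \<omega> t] in simp)
      then have "d \<omega> \<le> 1" unfolding d_def by (intro switched_dist_le_1) simp
      also have "\<dots> \<le> 1 + exp (- (\<gamma> / 2) * t)" by simp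
      finally show ?thesis using True by simp
    next
      case False
      then obtain k where k: "k \<le> n" "I (real k * h) \<omega> = J' (real k * h) \<omega>" using \<omega> by (auto simp: A_def)
      have "real k * h \<le> real n * h" using k h by simp
      then have kh: "real k * h \<le> t / 2" using nh by linarith
      have T0k: "T0 \<omega> \<le> ereal (real k * h)" unfolding T0_def using k h by (intro meeting_time_le) auto
      then have "T0 \<omega> \<le> ereal t" using kh t by (elim order_trans) simp
      then obtain T where T: "T0 \<omega> = ereal T" "0 \<le> T" "T \<le> t" "J t \<omega> = I t \<omega>"
        "norm (X t \<omega> - Y t \<omega>) \<le> exp (- \<gamma> * (t - T)) * norm (X T \<omega> - Y' T \<omega>)"
        using met[OF \<omega>] by blast
      have "T \<le> t / 2" using T0k T(1) kh by simp
      then have "\<gamma> * (t / 2) \<le> \<gamma> * (t - T)" using \<gamma> by (intro mult_left_mono) auto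
      then have "exp (- \<gamma> * (t - T)) * norm (X T \<omega> - Y' T \<omega>) \<le> exp (- (\<gamma> / 2) * t) * (2 * R)"
        using XY'[OF \<omega> T(2)] by (intro mult_mono) auto
      then have "norm (X t \<omega> - Y t \<omega>) / (2 * R) \<le> exp (- (\<gamma> / 2) * t)"
        using T(5) R by (simp add: pos_divide_le_eq)
      then show ?thesis using False T(4) by (simp add: d_def switched_dist_def)
    qed
    have comp: "I s \<in> measurable (vimage_algebra (space P) U S) (count_space UNIV)"
      "J' s \<in> measurable (vimage_algebra (space P) V S) (count_space UNIV)" if "s \<ge> 0" for s
      unfolding S_def U_def[abs_def] V_def[abs_def]
      using measurable_path_components(2)[OF that] by blast+
    have avoid: "expectation (\<lambda>\<omega>. Z \<omega> * indicator A \<omega>) \<le> (1 - p) ^ n * EZ"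
      unfolding A_def EZ_def
      using Z_pos Z_le h Y' p
      by (intro expectation_avoid_le[OF UV Z_meas, where b = 1] comp prob_avoid_path_le[where \<kappa> = \<kappa> and j = "snd v"])
        (auto simp: switched_process_def)
    have "A \<in> events"
    proof -
      have [measurable]: "I (real k * h) \<in> measurable P (count_space UNIV)"
        "J' (real k * h) \<in> measurable P (count_space UNIV)" for k
        using X Y' h by (simp_all add: switched_process_def markov_chain_def)
      show ?thesis unfolding A_def by measurable
    qed
    then have intZA: "integrable P (\<lambda>\<omega>. Z \<omega> * indicator A \<omega>)"
      using intZ by (rule integrable_real_mult_indicator)
    have "expectation (\<lambda>\<omega>. Z \<omega> / EZ * d \<omega>)
        \<le> expectation (\<lambda>\<omega>. (Z \<omega> * indicator A \<omega> + Z \<omega> * exp (- (\<gamma> / 2) * t)) / EZ)"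
    proof (rule integral_mono')
      show "integrable P (\<lambda>\<omega>. (Z \<omega> * indicator A \<omega> + Z \<omega> * exp (- (\<gamma> / 2) * t)) / EZ)"
        using intZ intZA by simp
      show "Z \<omega> / EZ * d \<omega> \<le> (Z \<omega> * indicator A \<omega> + Z \<omega> * exp (- (\<gamma> / 2) * t)) / EZ" if "\<omega> \<in> space P" for \<omega>
        using mult_left_mono[OF d_le[OF that], of "Z \<omega> / EZ"] Z_pos EZ
        by (simp add: add_divide_distrib distrib_left)
    qed (use Z_pos EZ in auto)
    also have "\<dots> = (expectation (\<lambda>\<omega>. Z \<omega> * indicator A \<omega>) + EZ * exp (- (\<gamma> / 2) * t)) / EZ"
      using intZ intZA by (simp add: EZ_def)
    also have "\<dots> \<le> ((1 - p) ^ n * EZ + EZ * exp (- (\<gamma> / 2) * t)) / EZ"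
      using avoid EZ by (intro divide_right_mono) auto
    also have "\<dots> = ((1 - p) ^ n + exp (- (\<gamma> / 2) * t)) * (EZ / EZ)"
      by (simp add: add_divide_distrib algebra_simps)
    also have "\<dots> \<le> ((1 - p) ^ n + exp (- (\<gamma> / 2) * t)) * 1"
      using q0 by (intro mult_left_mono) (auto intro!: add_nonneg_nonneg)
    finally show ?thesis unfolding goal_eq using False by (simp add: n_def switched_dist_def)
  qed
qed

end

section \<open>Exponential rate and final constants\<close>

text \<open>Rounding \<open>t / c\<close> down loses at most one factor \<open>q\<close>, which
  \<open>1 / q\<close> makes up for.\<close>

lemma power_floor_le_exp:
  fixes q :: real
  assumes q: "0 < q" "q \<le> 1" and "c > 0"
  shows "q ^ nat \<lfloor>t / c\<rfloor> \<le> 1 / q * exp (ln q / c * t)"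
proof -
  have "t / c - 1 \<le> real (nat \<lfloor>t / c\<rfloor>)" by linarith
  then have "real (nat \<lfloor>t / c\<rfloor>) * ln q \<le> (t / c - 1) * ln q"
    using q by (intro mult_right_mono_neg) auto
  then have "exp (real (nat \<lfloor>t / c\<rfloor>) * ln q) \<le> exp (ln q / c * t - ln q)"
    by (simp add: algebra_simps)
  then show ?thesis using q by (simp add: exp_of_nat_mult exp_diff)
qed

theorem proposition3p5:
  fixes \<kappa> :: "real \<Rightarrow> 'e::finite \<Rightarrow> 'e pmf"
    and F :: "'e \<Rightarrow> real^'k \<Rightarrow> real^'k"
    and \<phi> :: "'e \<Rightarrow> real \<Rightarrow> real^'k \<Rightarrow> real^'k"
    and \<rho> :: "(real^'k) \<times> 'e \<Rightarrow> real"
    and \<gamma> R :: real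
    and M :: "(real^'k) set" and E :: "((real^'k) \<times> 'e) set"
  assumes "transition_semigroup \<kappa>" and "irreducible_semigroup \<kappa>"
    and "\<And>i. forward_flow (F i) (\<phi> i)"
    and "\<gamma> > 0"
    and "\<And>i x y. (F i x - F i y) \<bullet> (x - y) \<le> - \<gamma> * (norm (x - y))\<^sup>2"
    and "R > 0" and "M = cball 0 R" and "\<And>i. positively_invariant (\<phi> i) M"
    and "E = M \<times> UNIV"
    and "\<And>u. u \<in> E \<Longrightarrow> \<rho> u \<ge> 0"
    and "\<exists>L. \<forall>u\<in>E. \<forall>v\<in>E. \<bar>\<rho> u - \<rho> v\<bar> \<le> L * switched_dist R u v"
  shows "\<exists>C\<^sub>A>0. \<exists>\<gamma>\<^sub>A>0. \<forall>u\<in>E. \<forall>v\<in>E. \<forall>(P :: 'w measure) X I Y J.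
           coupled_process P \<kappa> F u v X I Y J \<longrightarrow>
           (\<forall>t\<ge>0.
             (\<integral>\<omega>. penalization \<rho> X I t \<omega> / (\<integral>\<omega>'. penalization \<rho> X I t \<omega>' \<partial>P)
                   * switched_dist R (X t \<omega>, I t \<omega>) (Y t \<omega>, J t \<omega>) \<partial>P)
               \<le> C\<^sub>A * exp (- \<gamma>\<^sub>A * t) * switched_dist R u v)"
proof -
  obtain L where L: "\<And>u v. u \<in> E \<Longrightarrow> v \<in> E \<Longrightarrow> \<bar>\<rho> u - \<rho> v\<bar> \<le> L * switched_dist R u v"
    using assms(11) by blast
  have mono: "(F i x - F i y) \<bullet> (x - y) \<le> 0" for i x y
    using assms(4) assms(5)[of i x y] by (smt (verit) mult_minus_left mult_nonneg_nonneg zero_le_power2)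
  have inward: "F i x \<bullet> x \<le> 0" if "norm x \<ge> R" for i x
    using inner_le_0_outside_invariant_cball[OF assms(3) _ mono assms(6) that] assms(7,8) by simp
  interpret switched_system F \<rho> \<gamma> R L
    using assms(4,5,6,7,9,10) L inward by unfold_locales auto
  obtain h p where hp: "h > 0" "p > 0" "\<And>i j. pmf (\<kappa> h i) j \<ge> p"
    using transition_lower_bound[OF assms(1,2)] by blast
  have p1: "p \<le> 1" using hp(3)[of undefined undefined] pmf_le_1[of "\<kappa> h undefined" undefined] by linarith
  \<comment> \<open>The maximum with 1/2 keeps \<open>q\<close> positive when \<open>p = 1\<close>,
    so that \<open>ln q\<close> and \<open>1 / q\<close> are meaningful.\<close>
  define q where "q = max (1 - p) (1/2)"
  have q: "0 < q" "q < 1" "1 - p \<le> q" using hp(2) by (auto simp: q_def)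
  \<comment> \<open>The slower of the contraction rate and the meeting rate. Both are fixed before
    any process or probability space is chosen, which gives the uniformity in the statement.\<close>
  define \<gamma>' where "\<gamma>' = min (\<gamma> / 2) (- ln q / (2 * h))"
  have \<gamma>': "\<gamma>' > 0" using assms(4) hp(1) q by (simp add: \<gamma>'_def divide_neg_pos)
  have rate: "(1 - p) ^ nat \<lfloor>t / (2 * h)\<rfloor> + exp (- (\<gamma> / 2) * t) \<le> (1 / q + 1) * exp (- \<gamma>' * t)"
    if t: "t \<ge> 0" for t
  proof -
    have "(1 - p) ^ nat \<lfloor>t / (2 * h)\<rfloor> \<le> q ^ nat \<lfloor>t / (2 * h)\<rfloor>"
      using q p1 by (intro power_mono) auto
    also have "\<dots> \<le> 1 / q * exp (ln q / (2 * h) * t)"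
      using q hp(1) by (intro power_floor_le_exp) auto
    also have "\<dots> \<le> 1 / q * exp (- \<gamma>' * t)"
    proof -
      have "\<gamma>' * t \<le> - ln q / (2 * h) * t" using t by (intro mult_right_mono) (simp_all add: \<gamma>'_def)
      then show ?thesis using q by (intro mult_left_mono) auto
    qed
    finally have "(1 - p) ^ nat \<lfloor>t / (2 * h)\<rfloor> \<le> 1 / q * exp (- \<gamma>' * t)" .
    moreover have "exp (- (\<gamma> / 2) * t) \<le> exp (- \<gamma>' * t)"
    proof -
      have "\<gamma>' * t \<le> \<gamma> / 2 * t" using t by (intro mult_right_mono) (simp_all add: \<gamma>'_def)
      then show ?thesis by simp
    qed
    ultimately show ?thesis unfolding distrib_right mult_1_left by (rule add_mono)
  qed
  show ?thesis
  proof (rule exI[of _ "1 / q + 1"], rule conjI, goal_cases)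
    case 1
    show ?case using q by (simp add: add_pos_pos)
  next
    case 2
    show ?case
    proof (rule exI[of _ \<gamma>'], intro conjI ballI allI impI)
      show "\<gamma>' > 0" by (rule \<gamma>')
      fix u v and P :: "'w measure" and X I Y J and t :: real
      assume uv: "u \<in> E" "v \<in> E" and coupled: "coupled_process P \<kappa> F u v X I Y J" and t: "0 \<le> t"
      have "norm (fst u) \<le> R" "norm (fst v) \<le> R" using uv assms(7,9) by auto
      from weighted_distance_le[OF coupled this t hp(1,3)]
      show "(\<integral>\<omega>. penalization \<rho> X I t \<omega> / (\<integral>\<omega>'. penalization \<rho> X I t \<omega>' \<partial>P)
                     * switched_dist R (X t \<omega>, I t \<omega>) (Y t \<omega>, J t \<omega>) \<partial>P)
                 \<le> (1 / q + 1) * exp (- \<gamma>' * t) * switched_dist R u v"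
        using mult_right_mono[OF rate[OF t] switched_dist_nonneg[of u v]] by (rule order_trans)
    qed
  qed
qed

end
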